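(* Let $E,F$ be Banach spaces such that there exists a surjective bounded linear operator $\rho:E\to F$. If $\mathcal P_w({}^nE,F)$ is HB-smooth in $\mathcal P({}^nE,F)$ for some $n\in\mathbb N$, then $F$ is HB-smooth in $F^{**}$.
   Context: All Banach spaces are over $\mathbb K=\mathbb R$ or $\mathbb C$ (the same field for $E$ and $F$); $B_E$ is the closed unit ball, and $\mathbb N=\{1,2,\dots\}$. $\mathcal P({}^nE,F)$ is the Banach space of continuous $n$-homogeneous polynomials $P:E\to F$ with norm $\|P\|=\sup_{x\in B_E}\|P(x)\|$. $\mathcal P_w({}^nE,F)$ is the subspace of those polynomials that are weakly continuous on bounded sets, i.e. that map bounded weakly convergent nets to norm-convergent nets. A closed subspace $J$ of a Banach space $X$ is HB-smooth in $X$ if every $g\in J^*$ has a unique norm-preserving extension $f\in X^*$. $F$ is regarded as a subspace of $F^{**}$ through the canonical embedding. *)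

theory Defs
  imports "HOL-Analysis.Analysis" "HOL-Library.Function_Algebras"
begin

section \<open>Scalars and Banach spaces\<close>

text \<open>
  The scalar field \<open>\<K>\<close> is a type of the following class, which says that it is isometrically
  isomorphic to the real or to the complex numbers.
\<close>

class real_or_complex = real_normed_field +
  assumes real_or_complex:
    "(\<exists>h :: 'a \<Rightarrow> real. bij h \<and> (\<forall>a b. h (a + b) = h a + h b) \<and>
        (\<forall>a b. h (a * b) = h a * h b) \<and> (\<forall>a. norm (h a) = norm a)) \<or>
     (\<exists>h :: 'a \<Rightarrow> complex. bij h \<and> (\<forall>a b. h (a + b) = h a + h b) \<and>
        (\<forall>a b. h (a * b) = h a * h b) \<and> (\<forall>a. norm (h a) = norm a))"

instance real :: real_or_complex
  by standard (rule disjI1, rule exI[of _ "\<lambda>x. x"], simp add: bij_betw_def inj_on_def)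

instance complex :: real_or_complex
  by standard (rule disjI2, rule exI[of _ "\<lambda>x. x"], simp add: bij_betw_def inj_on_def)

text \<open>
  A Banach space over \<open>\<K>\<close> is a type of class \<^class>\<open>banach\<close> (its underlying real Banach space)
  together with a multiplication by scalars of \<open>\<K>\<close> that extends the real one.
\<close>

locale banach_space_over = vector_space scale
  for scale :: "'k :: real_or_complex \<Rightarrow> 'a :: banach \<Rightarrow> 'a" +
  assumes norm_scale: "norm (scale c x) = norm c * norm x"
    and scale_of_real: "scale (of_real r) x = r *\<^sub>R x"

lemma banach_space_over_real:
  "banach_space_over ((*\<^sub>R) :: real \<Rightarrow> 'a :: banach \<Rightarrow> 'a)"
  by unfold_locales (auto simp: algebra_simps)

section \<open>Dual spaces and HB-smoothness\<close>

text \<open>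
  The dual space, HB-smoothness etc. are needed for spaces of functions, so they are stated for a
  linear subspace \<open>X\<close> of an ambient \<open>\<K>\<close>-vector space with scalar multiplication \<open>s\<close>, and for a
  function \<open>N\<close> which is a norm on \<open>X\<close>. Vector addition on function types is pointwise
  (\<^theory>\<open>HOL-Library.Function_Algebras\<close>).

  The value 0 outside \<open>X\<close> makes a functional on \<open>X\<close> a uniquely determined HOL function, and keeps
  the dual closed under pointwise operations.
\<close>

definition dual ::
    "('k :: real_or_complex \<Rightarrow> 'v :: ab_group_add \<Rightarrow> 'v) \<Rightarrow> ('v \<Rightarrow> real) \<Rightarrow> 'v set \<Rightarrow> ('v \<Rightarrow> 'k) set"
  where "dual s N X =
    {f. (\<forall>x. x \<notin> X \<longrightarrow> f x = 0) \<and>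
        (\<forall>x\<in>X. \<forall>y\<in>X. f (x + y) = f x + f y) \<and>
        (\<forall>c. \<forall>x\<in>X. f (s c x) = c * f x) \<and>
        (\<exists>C. \<forall>x\<in>X. norm (f x) \<le> C * N x)}"

definition dual_norm :: "('v \<Rightarrow> real) \<Rightarrow> 'v set \<Rightarrow> ('v \<Rightarrow> 'k :: real_or_complex) \<Rightarrow> real"
  where "dual_norm N X f = (SUP x\<in>{x\<in>X. N x \<le> 1}. norm (f x))"

definition closed_subspace ::
    "('k :: real_or_complex \<Rightarrow> 'v :: ab_group_add \<Rightarrow> 'v) \<Rightarrow> ('v \<Rightarrow> real) \<Rightarrow> 'v set \<Rightarrow> 'v set \<Rightarrow> bool"
  where "closed_subspace s N J X \<longleftrightarrow>
    J \<subseteq> X \<and> module.subspace s J \<and>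
    (\<forall>x\<in>X. (\<forall>e>0. \<exists>y\<in>J. N (x - y) < e) \<longrightarrow> x \<in> J)"

definition HB_smooth ::
    "('k :: real_or_complex \<Rightarrow> 'v :: ab_group_add \<Rightarrow> 'v) \<Rightarrow> ('v \<Rightarrow> real) \<Rightarrow> 'v set \<Rightarrow> 'v set \<Rightarrow> bool"
  where "HB_smooth s N J X \<longleftrightarrow>
    closed_subspace s N J X \<and>
    (\<forall>g\<in>dual s N J. \<exists>!f. f \<in> dual s N X \<and> (\<forall>x\<in>J. f x = g x) \<and> dual_norm N X f = dual_norm N J g)"

definition fun_scale :: "('k \<Rightarrow> 'b \<Rightarrow> 'b) \<Rightarrow> 'k \<Rightarrow> ('a \<Rightarrow> 'b) \<Rightarrow> ('a \<Rightarrow> 'b)"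
  where "fun_scale s c f = (\<lambda>x. s c (f x))"

abbreviation dual_space ::
    "('k :: real_or_complex \<Rightarrow> 'a :: banach \<Rightarrow> 'a) \<Rightarrow> ('a \<Rightarrow> 'k) set"
  where "dual_space s \<equiv> dual s norm UNIV"

abbreviation dual_space_norm :: "('a :: banach \<Rightarrow> 'k :: real_or_complex) \<Rightarrow> real"
  where "dual_space_norm \<equiv> dual_norm norm UNIV"

definition bidual ::
    "('k :: real_or_complex \<Rightarrow> 'a :: banach \<Rightarrow> 'a) \<Rightarrow> (('a \<Rightarrow> 'k) \<Rightarrow> 'k) set"
  where "bidual s = dual (fun_scale (*)) dual_space_norm (dual_space s)"

definition bidual_norm ::
    "('k :: real_or_complex \<Rightarrow> 'a :: banach \<Rightarrow> 'a) \<Rightarrow> (('a \<Rightarrow> 'k) \<Rightarrow> 'k) \<Rightarrow> real"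
  where "bidual_norm s = dual_norm dual_space_norm (dual_space s)"

definition canonical_embedding ::
    "('k :: real_or_complex \<Rightarrow> 'a :: banach \<Rightarrow> 'a) \<Rightarrow> 'a \<Rightarrow> (('a \<Rightarrow> 'k) \<Rightarrow> 'k)"
  where "canonical_embedding s x = (\<lambda>\<phi>. if \<phi> \<in> dual_space s then \<phi> x else 0)"

section \<open>Homogeneous polynomials\<close>

text \<open>
  An \<open>n\<close>-linear map on \<open>E\<^sup>n\<close> is a function on lists, of which only the values on lists of length
  \<open>n\<close> matter.
\<close>

definition multilinear ::
    "('k :: real_or_complex \<Rightarrow> 'e :: banach \<Rightarrow> 'e) \<Rightarrow> ('k \<Rightarrow> 'f :: banach \<Rightarrow> 'f) \<Rightarrow> nat
      \<Rightarrow> ('e list \<Rightarrow> 'f) \<Rightarrow> bool"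
  where "multilinear sE sF n A \<longleftrightarrow>
    (\<forall>xs i. length xs = n \<longrightarrow> i < n \<longrightarrow> Vector_Spaces.linear sE sF (\<lambda>u. A (xs[i := u])))"

definition hom_polys ::
    "('k :: real_or_complex \<Rightarrow> 'e :: banach \<Rightarrow> 'e) \<Rightarrow> ('k \<Rightarrow> 'f :: banach \<Rightarrow> 'f) \<Rightarrow> nat
      \<Rightarrow> ('e \<Rightarrow> 'f) set"
  where "hom_polys sE sF n =
    {P. (\<exists>A. multilinear sE sF n A \<and> (\<forall>x. P x = A (replicate n x))) \<and> continuous_on UNIV P}"

definition poly_norm :: "('e :: banach \<Rightarrow> 'f :: banach) \<Rightarrow> real"
  where "poly_norm P = (SUP x\<in>cball 0 1. norm (P x))"

definition weakly_converges ::
    "('k :: real_or_complex \<Rightarrow> 'e :: banach \<Rightarrow> 'e) \<Rightarrow> ('i \<Rightarrow> 'e) \<Rightarrow> 'e \<Rightarrow> 'i filter \<Rightarrow> bool"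
  where "weakly_converges sE x a G \<longleftrightarrow> (\<forall>\<phi>\<in>dual_space sE. ((\<lambda>i. \<phi> (x i)) \<longlongrightarrow> \<phi> a) G)"

text \<open>
  Nets are rendered by filters. The definition uses filters on \<open>E\<close>; these are the images of the
  tail filters of nets in \<open>E\<close>, and the lemma below gives nets with an arbitrary index type.
\<close>

definition weakly_continuous_on_bounded ::
    "('k :: real_or_complex \<Rightarrow> 'e :: banach \<Rightarrow> 'e) \<Rightarrow> ('e \<Rightarrow> 'f :: banach) \<Rightarrow> bool"
  where "weakly_continuous_on_bounded sE P \<longleftrightarrow>
    (\<forall>G a. (\<exists>B. bounded B \<and> (\<forall>\<^sub>F x in G. x \<in> B)) \<longrightarrow> weakly_converges sE (\<lambda>x. x) a G
      \<longrightarrow> (P \<longlongrightarrow> P a) G)"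

lemma weakly_continuous_on_bounded_net:
  assumes "weakly_continuous_on_bounded sE P" "bounded B" "\<forall>\<^sub>F i in G. x i \<in> B"
    and "weakly_converges sE x a G"
  shows "((\<lambda>i. P (x i)) \<longlongrightarrow> P a) G"
proof -
  have "\<exists>B. bounded B \<and> (\<forall>\<^sub>F x in filtermap x G. x \<in> B)"
    using assms(2,3) by (auto simp: eventually_filtermap)
  moreover have "weakly_converges sE (\<lambda>x. x) a (filtermap x G)"
    using assms(4) by (simp add: weakly_converges_def filterlim_filtermap)
  ultimately have "(P \<longlongrightarrow> P a) (filtermap x G)"
    using assms(1) unfolding weakly_continuous_on_bounded_def by blast
  then show ?thesis
    by (simp add: filterlim_filtermap)
qed

text \<open>It makes no difference whether the limit is required to be the value at the weak limit.\<close>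

lemma weakly_continuous_on_bounded_iff_convergent:
  "weakly_continuous_on_bounded sE P \<longleftrightarrow>
    (\<forall>G a. (\<exists>B. bounded B \<and> (\<forall>\<^sub>F x in G. x \<in> B)) \<longrightarrow> weakly_converges sE (\<lambda>x. x) a G
      \<longrightarrow> (\<exists>l. (P \<longlongrightarrow> l) G))" (is "?L \<longleftrightarrow> ?R")
proof
  assume ?L
  then show ?R unfolding weakly_continuous_on_bounded_def by blast
next
  assume R: ?R
  show ?L unfolding weakly_continuous_on_bounded_def
  proof (intro allI impI)
    fix G a
    assume "\<exists>B. bounded B \<and> (\<forall>\<^sub>F x in G. x \<in> B)" and w: "weakly_converges sE (\<lambda>x. x) a G"
    then obtain B where B: "bounded B" "\<forall>\<^sub>F x in G. x \<in> B" by blast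
    let ?H = "sup G (principal {a})"
    have "bounded (insert a B) \<and> (\<forall>\<^sub>F x in ?H. x \<in> insert a B)"
      using B by (auto simp: eventually_sup eventually_principal elim: eventually_mono)
    moreover have "weakly_converges sE (\<lambda>x. x) a ?H"
      using w by (auto simp: weakly_converges_def filterlim_sup tendsto_principal_singleton)
    ultimately obtain l where l: "(P \<longlongrightarrow> l) ?H" using R by blast
    then have G: "(P \<longlongrightarrow> l) G" and "(P \<longlongrightarrow> l) (principal {a})"
      by (auto elim: tendsto_mono[rotated])
    then have "l = P a"
      using tendsto_unique[OF _ _ tendsto_principal_singleton] by (metis principal_eq_bot_iff insert_not_empty)
    with G show "(P \<longlongrightarrow> P a) G" by simp
  qed
qed

definition weak_hom_polys ::
    "('k :: real_or_complex \<Rightarrow> 'e :: banach \<Rightarrow> 'e) \<Rightarrow> ('k \<Rightarrow> 'f :: banach \<Rightarrow> 'f) \<Rightarrow> nat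
      \<Rightarrow> ('e \<Rightarrow> 'f) set"
  where "weak_hom_polys sE sF n = {P \<in> hom_polys sE sF n. weakly_continuous_on_bounded sE P}"

end

theory Submission
  imports Defs
begin

text \<open>
  Let \<open>f \<in> F\<^sup>*\<close> and let \<open>f'\<close> be a norm-preserving extension of \<open>f\<close> to \<open>F\<^sup>*\<^sup>*\<close>. One such extension is
  \<open>z \<mapsto> z f\<close>, so HB-smoothness of \<open>F\<close> in its bidual says that \<open>f' z = z f\<close> for all \<open>z \<in> F\<^sup>*\<^sup>*\<close>. The
  idea is to turn the two extensions of \<open>f\<close> into two extensions of one functional on the weakly
  continuous polynomials, to which the hypothesis applies.

  Since \<open>\<rho>\<close> is onto, there is \<open>\<Xi> \<in> E\<^sup>*\<^sup>*\<close> with \<open>\<Xi> (\<psi> \<circ> \<rho>) = z \<psi>\<close> for all \<open>\<psi> \<in> F\<^sup>*\<close>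
  (\<open>lift_to_bidual\<close>). By Goldstine's theorem some ultrafilter \<open>U\<close> on the ball of radius \<open>\<parallel>\<Xi>\<parallel>\<close> in
  \<open>E\<close> converges weak* to \<open>\<Xi>\<close>. Every continuous \<open>n\<close>-homogeneous polynomial \<open>P\<close> is bounded on that
  ball, hence has a weak* limit
  \<open>L P \<in> F\<^sup>*\<^sup>*\<close> along \<open>U\<close>, and \<open>\<parallel>L P\<parallel> \<le> \<parallel>P\<parallel> \<parallel>\<Xi>\<parallel>\<^sup>n\<close>. So \<open>\<Phi>\<^sub>1 P = f' (L P)\<close> and \<open>\<Phi>\<^sub>2 P = L P f\<close> define
  functionals of norm at most \<open>\<parallel>f\<parallel> \<parallel>\<Xi>\<parallel>\<^sup>n\<close>. Taking limits along an ultrafilter on the right ball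
  replaces the Aron-Berner extension of \<open>P\<close> and gives the norm estimate for free.

  Three observations finish the proof (\<open>extension_to_bidual_unique\<close>).
  First, if \<open>P\<close> is weakly continuous on bounded sets, then \<open>P\<close> converges in norm along \<open>U\<close>
  (\<open>tendsto_weakly_Cauchy\<close>), so \<open>L P \<in> F\<close> and \<open>\<Phi>\<^sub>1 P = \<Phi>\<^sub>2 P\<close>.
  Second, the polynomials \<open>x \<mapsto> \<phi>(x)\<^sup>n y\<close> are weakly continuous and show that the common
  restriction of \<open>\<Phi>\<^sub>1\<close> and \<open>\<Phi>\<^sub>2\<close> has norm exactly \<open>\<parallel>f\<parallel> \<parallel>\<Xi>\<parallel>\<^sup>n\<close>; both are therefore norm-preserving
  extensions of it, and they agree by hypothesis.
  Third, \<open>P x = \<phi>(x)\<^sup>n\<^sup>-\<^sup>1 \<rho> x\<close> has \<open>L P = \<Xi>(\<phi>)\<^sup>n\<^sup>-\<^sup>1 z\<close>, so that \<open>\<Phi>\<^sub>1 P = \<Phi>\<^sub>2 P\<close> reads \<open>f' z = z f\<close> as soon as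
  \<open>\<Xi> \<phi> \<noteq> 0\<close>; if there is no such \<open>\<phi>\<close>, then \<open>z = 0\<close>.

  The functional analysis behind this (Hahn-Banach in norming form, the open mapping theorem,
  Goldstine's theorem) is proved on the way, for both scalar fields at once.
\<close>

section \<open>The scalar field\<close>

text \<open>
  Real and imaginary parts, conjugation and compactness of closed balls are taken from \<open>\<complex>\<close> through
  an isometric embedding \<open>h\<close>; treating \<open>\<real>\<close> as a subfield of \<open>\<complex>\<close> avoids two copies of each argument.
  It fixes the reals because it maps \<open>1\<close> to \<open>1\<close> and preserves distances: a complex number with the
  same distances to \<open>1\<close> and \<open>-1\<close> as the real number \<open>r\<close> has real part \<open>r\<close>, and then \<open>r\<close> is the only one at the right
  distance from \<open>-1\<close>.
\<close>

lemma scalar_embedding: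
  obtains h :: "'k :: real_or_complex \<Rightarrow> complex"
  where "\<And>a b. h (a + b) = h a + h b" "\<And>a b. h (a * b) = h a * h b" "\<And>a. norm (h a) = norm a"
    "\<And>a b. h (a - b) = h a - h b" "\<And>r. h (of_real r) = of_real r"
    "range h = UNIV \<or> range h = \<real>" "inj h"
proof -
  note result = that
  have *: thesis if add: "\<And>a b. h (a + b) = h a + h b" and mult: "\<And>a b. h (a * b) = h a * h b"
    and norm: "\<And>a. norm (h a) = norm a" and range: "range h = UNIV \<or> range h = \<real>"
    for h :: "'k \<Rightarrow> complex"
  proof -
    have diff: "h (a - b) = h a - h b" for a b
      using add[of "a - b" b] by (simp add: algebra_simps)
    have "h 1 * h 1 = h 1" "h 1 \<noteq> 0"
      using mult[of 1 1] norm[of 1] by auto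
    then have one: "h 1 = 1" by simp
    have real: "h (of_real r) = of_real r" for r
    proof -
      have norm_real: "norm (of_real s :: 'k) = \<bar>s\<bar>" for s by simp
      have "norm (h (of_real r) + 1) = \<bar>r + 1\<bar>"
        using norm[of "of_real r + 1"] norm_real[of "r + 1"] add[of "of_real r" 1] one by simp
      then have 1: "(Re (h (of_real r)) + 1)\<^sup>2 + (Im (h (of_real r)))\<^sup>2 = (r + 1)\<^sup>2"
        using cmod_power2[of "h (of_real r) + 1"] by simp
      have "norm (h (of_real r) - 1) = \<bar>r - 1\<bar>"
        using norm[of "of_real r - 1"] norm_real[of "r - 1"] diff[of "of_real r" 1] one by simp
      then have 2: "(Re (h (of_real r)) - 1)\<^sup>2 + (Im (h (of_real r)))\<^sup>2 = (r - 1)\<^sup>2"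
        using cmod_power2[of "h (of_real r) - 1"] by simp
      have "Re (h (of_real r)) = r"
        using 1 2 by (simp add: power2_eq_square algebra_simps)
      with 1 show ?thesis by (simp add: complex_eq_iff)
    qed
    have "inj h"
      by (rule injI) (metis diff norm norm_eq_zero right_minus_eq)
    with add mult norm diff real range show thesis by (intro result)
  qed
  from real_or_complex[where 'a = 'k] show thesis
  proof (elim disjE exE conjE)
    fix h :: "'k \<Rightarrow> real"
    assume h: "bij h" "\<forall>a b. h (a + b) = h a + h b" "\<forall>a b. h (a * b) = h a * h b"
      "\<forall>a. norm (h a) = norm a"
    have "range (\<lambda>a. complex_of_real (h a)) = \<real>"
      using \<open>bij h\<close> unfolding Reals_def bij_def by (metis image_image)
    then show thesis
      using * [of "\<lambda>a. complex_of_real (h a)"] h by simp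
  next
    fix h :: "'k \<Rightarrow> complex"
    assume h: "bij h" "\<forall>a b. h (a + b) = h a + h b" "\<forall>a b. h (a * b) = h a * h b"
      "\<forall>a. norm (h a) = norm a"
    then show thesis using *[of h] by (auto simp: bij_def)
  qed
qed

section \<open>Ultrafilters\<close>

definition ultrafilter :: "'a filter \<Rightarrow> bool"
  where "ultrafilter U \<longleftrightarrow> U \<noteq> bot \<and> (\<forall>P. eventually P U \<or> eventually (\<lambda>x. \<not> P x) U)"

lemma ex_ultrafilter_le:
  assumes "F \<noteq> bot"
  obtains U where "ultrafilter U" "U \<le> F"
proof -
  define A where "A = {U. U \<noteq> bot \<and> U \<le> F}"
  have "\<exists>U\<in>A. \<forall>V\<in>A. (\<ge>) U V \<longrightarrow> V = U"
  proof (rule predicate_Zorn)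
    show "partial_order_on A (relation_of (\<ge>) A)"
      by (auto simp: partial_order_on_def preorder_on_def refl_on_def trans_def antisym_def
          relation_of_def)
    fix C assume C: "C \<in> Chains (relation_of (\<ge>) A)"
    show "\<exists>u\<in>A. \<forall>V\<in>C. V \<ge> u"
    proof (cases "C = {}")
      case True
      then show ?thesis using assms by (auto simp: A_def)
    next
      case False
      have CA: "C \<subseteq> A" and tot: "\<And>V W. V \<in> C \<Longrightarrow> W \<in> C \<Longrightarrow> V \<le> W \<or> W \<le> V"
        using C by (auto simp: Chains_def relation_of_def)
      have "\<not> eventually (\<lambda>x. False) (Inf C)"
      proof (subst eventually_Inf_base[OF False])
        show "\<exists>x\<in>C. x \<le> inf V W" if "V \<in> C" "W \<in> C" for V W
          using tot[OF that] that by (metis inf.absorb1 inf.absorb2 order.refl)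
        show "\<not> (\<exists>b\<in>C. eventually (\<lambda>x. False) b)"
          using CA by (auto simp: A_def trivial_limit_def)
      qed
      moreover have "Inf C \<le> F" using False CA by (auto simp: A_def intro: Inf_lower2)
      ultimately have "Inf C \<in> A" by (simp add: A_def trivial_limit_def)
      then show ?thesis by (auto intro: Inf_lower)
    qed
  qed
  then obtain U where U: "U \<noteq> bot" "U \<le> F" and max: "\<And>V. V \<in> A \<Longrightarrow> V \<le> U \<Longrightarrow> V = U"
    by (auto simp: A_def)
  have "eventually P U \<or> eventually (\<lambda>x. \<not> P x) U" for P
  proof (rule disjCI)
    assume P: "\<not> eventually (\<lambda>x. \<not> P x) U"
    have "inf U (principal {x. P x}) \<noteq> bot"
      using P by (simp add: trivial_limit_def eventually_inf_principal)
    then have "inf U (principal {x. P x}) = U"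
      using U by (intro max) (auto simp: A_def intro: le_infI1)
    moreover have "eventually P (inf U (principal {x. P x}))"
      by (simp add: eventually_inf_principal)
    ultimately show "eventually P U" by (simp only:)
  qed
  with U that show thesis by (auto simp: ultrafilter_def)
qed

text \<open>
  A compact set contains a cluster point of any filter on it, and a cluster point of an
  ultrafilter is a limit.
\<close>

lemma ultrafilter_tendsto_compact:
  fixes f :: "'a \<Rightarrow> 'b :: topological_space"
  assumes "ultrafilter U" "compact S" "\<forall>\<^sub>F x in U. f x \<in> S"
  obtains l where "l \<in> S" "(f \<longlongrightarrow> l) U"
proof -
  have "filtermap f U \<noteq> bot" "\<forall>\<^sub>F y in filtermap f U. y \<in> S"
    using assms by (auto simp: ultrafilter_def filtermap_bot_iff eventually_filtermap)
  with \<open>compact S\<close> obtain l where l: "l \<in> S" "inf (nhds l) (filtermap f U) \<noteq> bot"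
    unfolding compact_filter by blast
  have "\<forall>\<^sub>F x in U. f x \<in> A" if A: "open A" "l \<in> A" for A
  proof (rule ccontr)
    assume "\<not> ?thesis"
    then have "\<forall>\<^sub>F x in U. f x \<notin> A" using assms(1) by (auto simp: ultrafilter_def)
    then have "\<forall>\<^sub>F y in inf (nhds l) (filtermap f U). False"
      using A unfolding eventually_inf
      by (intro exI[of _ "\<lambda>y. y \<in> A"] exI[of _ "\<lambda>y. y \<notin> A"])
        (auto simp: eventually_filtermap eventually_nhds)
    with l show False by (simp add: trivial_limit_def)
  qed
  with l that show thesis by (auto simp: tendsto_def)
qed

lemma ultrafilter_tendsto_scalar:
  fixes f :: "'a \<Rightarrow> 'k :: real_or_complex"
  assumes "ultrafilter U" "\<forall>\<^sub>F x in U. norm (f x) \<le> B"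
  obtains l where "(f \<longlongrightarrow> l) U"
proof -
  obtain h :: "'k \<Rightarrow> complex" where h: "\<And>a. norm (h a) = norm a" "\<And>a b. h (a - b) = h a - h b"
    "range h = UNIV \<or> range h = \<real>"
    by (rule scalar_embedding) blast
  have "closed (range h)"
    using h(3) closed_complex_Reals by auto
  then have "compact (cball 0 B \<inter> range h)" by auto
  moreover have "\<forall>\<^sub>F x in U. h (f x) \<in> cball 0 B \<inter> range h"
    using assms(2) by (simp add: h(1))
  ultimately obtain l where "l \<in> cball 0 B \<inter> range h" and lim: "((\<lambda>x. h (f x)) \<longlongrightarrow> l) U"
    by (rule ultrafilter_tendsto_compact[OF assms(1)])
  then obtain c where "l = h c" by blast
  with lim have "(f \<longlongrightarrow> c) U"
    unfolding tendsto_iff dist_norm by (simp only: h(1) flip: h(2))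
  then show thesis ..
qed

section \<open>The open mapping theorem\<close>

text \<open>
  The Baire category step of the open mapping theorem: the closures of the images of the balls of
  integer radius cover the codomain, so one of them contains a ball. Differences of its elements
  approximate all small vectors by images of bounded vectors, and scaling gives the estimate.
\<close>

lemma approximate_preimage:
  fixes T :: "'a :: banach \<Rightarrow> 'b :: banach"
  assumes T: "bounded_linear T" and "surj T"
  shows "\<exists>M>0. \<forall>y. \<exists>x. norm x \<le> M * norm y \<and> norm (y - T x) \<le> norm y / 2"
proof -
  interpret T: bounded_linear T by fact
  let ?C = "\<lambda>n::nat. closure (T ` cball 0 (real n))"
  have "\<Union>(range ?C) = UNIV"
  proof safe
    fix y
    obtain x where x: "y = T x" using \<open>surj T\<close> by blast
    obtain n :: nat where "norm x \<le> real n" using real_arch_simple by blast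
    then have "T x \<in> ?C n" by (intro subsetD[OF closure_subset] imageI) simp
    then show "y \<in> \<Union>(range ?C)" using x by blast
  qed simp
  then have "\<exists>n. interior (?C n) \<noteq> {}"
    using Baire_category_alt[of "euclidean :: 'b topology" "range ?C"]
    by (auto simp: completely_metrizable_space_euclidean)
  then obtain n y0 where "y0 \<in> interior (?C n)" by blast
  then obtain e where e: "e > 0" and ball: "ball y0 e \<subseteq> ?C n"
    unfolding mem_interior by blast
  \<comment> \<open>A vector of norm \<open>e / 2\<close> is a difference of two approximants from the image of \<open>cball 0 n\<close>,
    so its preimage has norm at most \<open>2 n\<close>; the summand 1 makes \<open>M\<close> positive also for \<open>n = 0\<close>.\<close>
  define M where "M = (4 * real n + 1) / e"
  have "M > 0" using e by (simp add: M_def add_nonneg_pos)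
  moreover have "\<exists>x. norm x \<le> M * norm y \<and> norm (y - T x) \<le> norm y / 2" for y
  proof (cases "y = 0")
    case True
    then show ?thesis by (intro exI[of _ 0]) (simp add: T.zero)
  next
    case False
    define t where "t = e / (2 * norm y)"
    have t: "t > 0" using e False by (simp add: t_def)
    have "t * norm y < e" using e False by (simp add: t_def)
    with t have "y0 + t *\<^sub>R y \<in> ball y0 e" by (simp add: dist_norm)
    with ball e have "y0 \<in> ?C n" "y0 + t *\<^sub>R y \<in> ?C n" by auto
    moreover have "t * norm y / 4 > 0" using t False by simp
    ultimately have "\<exists>v\<in>T ` cball 0 (real n). dist v y0 < t * norm y / 4"
      "\<exists>v\<in>T ` cball 0 (real n). dist v (y0 + t *\<^sub>R y) < t * norm y / 4"
      unfolding closure_approachable by blast+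
    then obtain x1 x2 where x: "norm x1 \<le> n" "norm x2 \<le> n"
      "dist (T x1) y0 < t * norm y / 4" "dist (T x2) (y0 + t *\<^sub>R y) < t * norm y / 4"
      by auto
    define x where "x = (1 / t) *\<^sub>R (x2 - x1)"
    have "norm (x2 - x1) \<le> 2 * real n" using x norm_triangle_ineq4[of x2 x1] by linarith
    then have "norm x \<le> (1 / t) * (2 * real n)"
      using t by (simp add: x_def divide_right_mono)
    also have "\<dots> = (4 * real n) / e * norm y" by (simp add: t_def)
    also have "\<dots> \<le> M * norm y"
      using e by (intro mult_right_mono) (auto simp: M_def divide_right_mono)
    finally have 1: "norm x \<le> M * norm y" .
    have eq: "t *\<^sub>R (y - T x) = (T x1 - y0) - (T x2 - (y0 + t *\<^sub>R y))"
      using t by (simp add: x_def T.scaleR T.diff algebra_simps)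
    have "t * norm (y - T x) = norm (t *\<^sub>R (y - T x))" using t by simp
    also have "\<dots> \<le> norm (T x1 - y0) + norm (T x2 - (y0 + t *\<^sub>R y))"
      unfolding eq by (rule norm_triangle_ineq4)
    also have "\<dots> \<le> t * norm y / 4 + t * norm y / 4"
      using x(3,4) by (simp add: dist_norm)
    finally have "t * norm (y - T x) \<le> t * (norm y / 2)" by simp
    with t have "norm (y - T x) \<le> norm y / 2" by (simp only: mult_le_cancel_left_pos)
    with 1 show ?thesis by blast
  qed
  ultimately show ?thesis by blast
qed

text \<open>
  Iterating \<open>approximate_preimage\<close> on the remainders halves the error in each step, so the
  approximate preimages sum to an exact one. The right inverse is in general neither linear nor
  continuous, but bounded sets of the codomain lift to bounded sets, which is all that lifting
  filters needs.
\<close>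

lemma bounded_right_inverse:
  fixes T :: "'a :: banach \<Rightarrow> 'b :: banach"
  assumes T: "bounded_linear T" and "surj T"
  shows "\<exists>S C. C \<ge> 0 \<and> (\<forall>y. T (S y) = y) \<and> (\<forall>y. norm (S y) \<le> C * norm y)"
proof -
  interpret T: bounded_linear T by fact
  obtain M where M: "M > 0" "\<forall>y. \<exists>x. norm x \<le> M * norm y \<and> norm (y - T x) \<le> norm y / 2"
    using approximate_preimage[OF assms] by blast
  from choice[OF M(2)] obtain G
    where "\<forall>y. norm (G y) \<le> M * norm y \<and> norm (y - T (G y)) \<le> norm y / 2" ..
  then have G: "\<And>y. norm (G y) \<le> M * norm y" "\<And>y. norm (y - T (G y)) \<le> norm y / 2"
    by blast+
  have "\<exists>x. T x = y \<and> norm x \<le> 2 * M * norm y" for y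
  proof -
    define r where "r = rec_nat y (\<lambda>_ z. z - T (G z))"
    have r0: "r 0 = y" by (simp add: r_def)
    have rS: "r (Suc k) = r k - T (G (r k))" for k
      unfolding r_def by (rule nat.rec(2))
    have r: "norm (r k) \<le> norm y * (1 / 2) ^ k" for k
    proof (induction k)
      case (Suc k)
      then show ?case using G(2)[of "r k"] by (simp add: rS)
    qed (simp add: r0)
    have Gr: "norm (G (r k)) \<le> M * norm y * (1 / 2) ^ k" for k
    proof -
      have "M * norm (r k) \<le> M * (norm y * (1 / 2) ^ k)"
        using M(1) by (intro mult_left_mono r) auto
      then show ?thesis using G(1)[of "r k"] unfolding mult.assoc by linarith
    qed
    have geo: "(\<lambda>k. M * norm y * (1 / 2) ^ k) sums (M * norm y * 2)"
    proof -
      have "(\<lambda>k. (1 / 2) ^ k) sums (2 :: real)" using geometric_sums[of "1 / 2 :: real"] by simp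
      then show ?thesis by (rule sums_mult)
    qed
    have sn: "summable (\<lambda>k. norm (G (r k)))"
    proof (rule summable_comparison_test'[OF sums_summable[OF geo]])
      show "norm (norm (G (r k))) \<le> M * norm y * (1 / 2) ^ k" if "k \<ge> 0" for k
        using Gr[of k] by (simp only: real_norm_def abs_norm_cancel)
    qed
    then have s: "summable (\<lambda>k. G (r k))" by (rule summable_norm_cancel)
    have "r \<longlonglongrightarrow> 0"
    proof (rule Lim_null_comparison)
      show "\<forall>\<^sub>F k in sequentially. norm (r k) \<le> norm y * (1 / 2) ^ k"
        by (intro always_eventually allI r)
      show "(\<lambda>k. norm y * (1 / 2) ^ k) \<longlonglongrightarrow> 0"
        by (intro tendsto_mult_right_zero LIMSEQ_power_zero) simp
    qed
    then have "(\<lambda>k. r k - r (Suc k)) sums y"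
      using telescope_sums'[of r 0] by (simp only: r0 diff_zero)
    moreover have "r k - r (Suc k) = T (G (r k))" for k unfolding rS by simp
    ultimately have "(\<lambda>k. T (G (r k))) sums y" by simp
    moreover have "(\<lambda>k. T (G (r k))) sums T (\<Sum>k. G (r k))"
      using s by (intro T.sums summable_sums)
    ultimately have "T (\<Sum>k. G (r k)) = y" using sums_unique2 by blast
    moreover have "norm (\<Sum>k. G (r k)) \<le> 2 * M * norm y"
    proof -
      have "norm (\<Sum>k. G (r k)) \<le> (\<Sum>k. norm (G (r k)))" by (rule summable_norm[OF sn])
      also have "\<dots> \<le> M * norm y * 2"
        using suminf_le[OF Gr sn sums_summable[OF geo]] sums_unique[OF geo] by simp
      finally show ?thesis by simp
    qed
    ultimately show ?thesis by blast
  qed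
  then have "\<forall>y. \<exists>x. T x = y \<and> norm x \<le> 2 * M * norm y" ..
  from choice[OF this] obtain S where "\<forall>y. T (S y) = y \<and> norm (S y) \<le> 2 * M * norm y" ..
  with M(1) show ?thesis by (intro exI[of _ S] exI[of _ "2 * M"]) auto
qed

section \<open>The Hahn--Banach theorem\<close>

definition sublinear :: "('a :: real_vector \<Rightarrow> real) \<Rightarrow> bool"
  where "sublinear p \<longleftrightarrow> (\<forall>x y. p (x + y) \<le> p x + p y) \<and> (\<forall>t>0. \<forall>x. p (t *\<^sub>R x) = t * p x)"

lemma sublinear_zero: "sublinear p \<Longrightarrow> p 0 = 0"
  unfolding sublinear_def by (metis mult_2 add_cancel_right_left scaleR_zero_right zero_less_numeral)

lemma sublinear_minus:
  assumes "sublinear p"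
  shows "- p (- x) \<le> p x"
proof -
  have "p (x + - x) \<le> p x + p (- x)" using assms unfolding sublinear_def by blast
  then show ?thesis using sublinear_zero[OF assms] by simp
qed

text \<open>
  Zorn's lemma for the pointwise order. Lower bounds of chains are pointwise infima: these are
  finite because \<open>- q (- x)\<close> bounds every sublinear functional below \<open>q\<close> from below, and they are
  subadditive because two members of a chain have a common smaller one.
\<close>

lemma ex_minimal_sublinear:
  assumes q: "sublinear (q :: 'a :: real_vector \<Rightarrow> real)"
  shows "\<exists>m. sublinear m \<and> m \<le> q \<and> (\<forall>p. sublinear p \<longrightarrow> p \<le> m \<longrightarrow> p = m)"
proof -
  define A where "A = {p. sublinear p \<and> p \<le> q}"
  have "\<exists>m\<in>A. \<forall>p\<in>A. (\<ge>) m p \<longrightarrow> p = m"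
  proof (rule predicate_Zorn)
    show "partial_order_on A (relation_of (\<ge>) A)"
      by (auto simp: partial_order_on_def preorder_on_def refl_on_def trans_def antisym_def
          relation_of_def)
    fix C assume C: "C \<in> Chains (relation_of (\<ge>) A)"
    show "\<exists>u\<in>A. \<forall>p\<in>C. p \<ge> u"
    proof (cases "C = {}")
      case True
      then show ?thesis using q by (auto simp: A_def)
    next
      case False
      have CA: "C \<subseteq> A" and tot: "\<And>c d. c \<in> C \<Longrightarrow> d \<in> C \<Longrightarrow> c \<le> d \<or> d \<le> c"
        using C by (auto simp: Chains_def relation_of_def)
      have sub: "sublinear c" and le: "c x \<le> q x" if "c \<in> C" for c x
        using CA that by (auto simp: A_def le_fun_def)
      have bdd: "bdd_below ((\<lambda>c. c x) ` C)" for x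
      proof (rule bdd_belowI2)
        fix c assume "c \<in> C"
        then show "- q (- x) \<le> c x"
          using sublinear_minus[OF sub, of c x] le[of c "- x"] by linarith
      qed
      define u where "u x = (INF c\<in>C. c x)" for x
      have u_le: "u x \<le> c x" if "c \<in> C" for c x
        unfolding u_def by (rule cINF_lower[OF bdd that])
      have u_ge: "b \<le> u x" if "\<And>c. c \<in> C \<Longrightarrow> b \<le> c x" for b x
        unfolding u_def by (rule cINF_greatest[OF False that])
      have "u (x + y) \<le> u x + u y" for x y
      proof -
        have *: "u (x + y) \<le> c x + d y" if cd: "c \<in> C" "d \<in> C" for c d
        proof -
          obtain e where e: "e \<in> C" "e \<le> c" "e \<le> d" using tot[OF cd] cd by blast
          have "u (x + y) \<le> e (x + y)" using e by (intro u_le)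
          also have "\<dots> \<le> e x + e y" using sub[OF e(1)] by (simp add: sublinear_def)
          also have "\<dots> \<le> c x + d y" using e by (intro add_mono) (auto simp: le_fun_def)
          finally show ?thesis .
        qed
        have "u (x + y) - c x \<le> u y" if c: "c \<in> C" for c
        proof (rule u_ge)
          fix d assume "d \<in> C"
          with *[OF c, of d] show "u (x + y) - c x \<le> d y" by linarith
        qed
        then have "u (x + y) - u y \<le> u x"
          by (intro u_ge) (simp add: algebra_simps)
        then show ?thesis by simp
      qed
      moreover have "u (t *\<^sub>R x) = t * u x" if "t > 0" for t x
      proof (rule antisym)
        have *: "s * u y \<le> u (s *\<^sub>R y)" if s: "s > 0" for s y
        proof (rule u_ge)
          fix c assume c: "c \<in> C"
          have "c (s *\<^sub>R y) = s * c y" using sub[OF c] s by (simp add: sublinear_def)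
          then show "s * u y \<le> c (s *\<^sub>R y)" using u_le[OF c, of y] s by simp
        qed
        show "t * u x \<le> u (t *\<^sub>R x)" using * that .
        have "(1 / t) * u (t *\<^sub>R x) \<le> u x"
          using *[of "1 / t" "t *\<^sub>R x"] that by simp
        then show "u (t *\<^sub>R x) \<le> t * u x" using that by (simp add: field_simps)
      qed
      ultimately have "sublinear u" by (simp add: sublinear_def)
      moreover have "u \<le> q"
      proof (rule le_funI)
        fix x
        obtain c where "c \<in> C" using False by blast
        then show "u x \<le> q x" using u_le le by (meson order_trans)
      qed
      ultimately have "u \<in> A" by (simp add: A_def)
      then show ?thesis using u_le by (auto simp: le_fun_def)
    qed
  qed
  then obtain m where m: "m \<in> A" "\<And>p. p \<in> A \<Longrightarrow> p \<le> m \<Longrightarrow> p = m" by blast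
  have "p = m" if "sublinear p" "p \<le> m" for p
    using m that by (auto simp: A_def intro: order_trans)
  with m(1) show ?thesis by (auto simp: A_def)
qed

text \<open>
  The functional \<open>x \<mapsto> inf\<^sub>t (p (x + t a) - t p a)\<close> over \<open>t \<ge> 0\<close> lies below \<open>p\<close> and takes the value
  \<open>- p a\<close> or less at \<open>- a\<close>. Minimal functionals must equal it for each \<open>a\<close>, which makes them additive;
  applied to a norm it produces a functional that forces a prescribed vector to be normed.
\<close>

lemma sublinear_directional:
  fixes p :: "'a :: real_vector \<Rightarrow> real"
  assumes p: "sublinear p"
  shows "\<exists>r. sublinear r \<and> r \<le> p \<and> (\<forall>x. r x \<le> p (x + a) - p a)"
proof -
  have add: "p (x + y) \<le> p x + p y" for x y using p by (simp add: sublinear_def)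
  have scale: "p (t *\<^sub>R x) = t * p x" if "t \<ge> 0" for t x
    using p that sublinear_zero[OF p] by (cases "t = 0") (auto simp: sublinear_def)
  define r where "r x = (INF t\<in>{0..}. p (x + t *\<^sub>R a) - t * p a)" for x
  have bdd: "bdd_below ((\<lambda>t. p (x + t *\<^sub>R a) - t * p a) ` {0..})" for x
  proof (rule bdd_belowI2)
    fix t :: real assume "t \<in> {0..}"
    then have "t * p a \<le> p (x + t *\<^sub>R a) + p (- x)"
      using add[of "x + t *\<^sub>R a" "- x"] scale[of t a] by simp
    then show "- p (- x) \<le> p (x + t *\<^sub>R a) - t * p a" by simp
  qed
  have r_le: "r x \<le> p (x + t *\<^sub>R a) - t * p a" if "t \<ge> 0" for x t
    unfolding r_def using that by (intro cINF_lower bdd) auto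
  have r_ge: "b \<le> r x" if "\<And>t. t \<ge> 0 \<Longrightarrow> b \<le> p (x + t *\<^sub>R a) - t * p a" for b x
    unfolding r_def using that by (intro cINF_greatest) auto
  have "r (x + y) \<le> r x + r y" for x y
  proof -
    have *: "r (x + y) \<le> (p (x + s *\<^sub>R a) - s * p a) + (p (y + t *\<^sub>R a) - t * p a)"
      if "s \<ge> 0" "t \<ge> 0" for s t
      using r_le[of "s + t" "x + y"] add[of "x + s *\<^sub>R a" "y + t *\<^sub>R a"] that
      by (simp add: algebra_simps)
    have "r (x + y) - (p (x + s *\<^sub>R a) - s * p a) \<le> r y" if "s \<ge> 0" for s
      using *[OF that] by (intro r_ge) (simp add: algebra_simps)
    then have "r (x + y) - r y \<le> r x"
      by (intro r_ge) (simp add: algebra_simps)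
    then show ?thesis by simp
  qed
  moreover have "r (t *\<^sub>R x) = t * r x" if "t > 0" for t x
  proof (rule antisym)
    have *: "s * r y \<le> r (s *\<^sub>R y)" if s: "s > 0" for s y
    proof (rule r_ge)
      fix t :: real assume t: "t \<ge> 0"
      have "s * r y \<le> s * (p (y + (t / s) *\<^sub>R a) - (t / s) * p a)"
        using s t by (intro mult_left_mono r_le) auto
      also have "\<dots> = p (s *\<^sub>R (y + (t / s) *\<^sub>R a)) - t * p a"
        using s scale[of s "y + (t / s) *\<^sub>R a"] by (simp add: right_diff_distrib)
      finally show "s * r y \<le> p (s *\<^sub>R y + t *\<^sub>R a) - t * p a"
        using s by (simp add: scaleR_right_distrib)
    qed
    show "t * r x \<le> r (t *\<^sub>R x)" using * that .
    have "(1 / t) * r (t *\<^sub>R x) \<le> r x"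
      using *[of "1 / t" "t *\<^sub>R x"] that by simp
    then show "r (t *\<^sub>R x) \<le> t * r x" using that by (simp add: field_simps)
  qed
  ultimately have "sublinear r" by (simp add: sublinear_def)
  moreover have "r \<le> p" using r_le[of 0] by (auto simp: le_fun_def)
  moreover have "r x \<le> p (x + a) - p a" for x using r_le[of 1 x] by simp
  ultimately show ?thesis by blast
qed

text \<open>
  Start from the norm, made small at \<open>- y\<close> by \<open>sublinear_directional\<close>, and take a minimal
  sublinear functional below it: minimality makes it linear, and smallness at \<open>- y\<close> gives the
  lower bound at \<open>y\<close>.
\<close>

lemma real_norming_functional:
  fixes y :: "'a :: real_normed_vector"
  obtains g :: "'a \<Rightarrow> real"
  where "linear g" "\<And>x. g x \<le> norm x" "g y \<ge> norm y"
proof -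
  have "sublinear (norm :: 'a \<Rightarrow> real)" by (auto simp: sublinear_def norm_triangle_ineq)
  then obtain q where q: "sublinear q" "\<And>x. q x \<le> norm x" "\<And>x. q x \<le> norm (x + y) - norm y"
    using sublinear_directional[of norm y] by (auto simp: le_fun_def)
  obtain m where m: "sublinear m" "m \<le> q" and min: "\<And>p. sublinear p \<Longrightarrow> p \<le> m \<Longrightarrow> p = m"
    using ex_minimal_sublinear[OF q(1)] by blast
  have "m (x + a) = m x + m a" for x a
  proof (rule antisym)
    show "m (x + a) \<le> m x + m a" using m(1) by (simp add: sublinear_def)
    obtain r where r: "sublinear r" "r \<le> m" "\<And>x. r x \<le> m (x + a) - m a"
      using sublinear_directional[OF m(1), of a] by blast
    then have "r = m" using min by blast
    then show "m x + m a \<le> m (x + a)" using r(3)[of x] by simp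
  qed
  note add = this
  have minus: "m (- x) = - m x" for x
    using add[of x "- x"] sublinear_zero[OF m(1)] by simp
  have "m (t *\<^sub>R x) = t * m x" for t x
  proof (cases "t > 0 \<or> t = 0")
    case True
    then show ?thesis using m(1) sublinear_zero[OF m(1)] by (auto simp: sublinear_def)
  next
    case False
    then have "m ((- t) *\<^sub>R x) = (- t) * m x" using m(1) unfolding sublinear_def
      by (metis neg_0_less_iff_less linorder_less_linear)
    then show ?thesis using minus[of "t *\<^sub>R x"] by simp
  qed
  with add have "linear m" by (intro linearI) auto
  moreover have "m x \<le> norm x" for x
    using m(2) q(2)[of x] by (meson le_funD order_trans)
  moreover have "m y \<ge> norm y"
    using le_funD[OF m(2), of "- y"] q(3)[of "- y"] minus[of y] by simp
  ultimately show thesis by (rule that)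
qed

text \<open>
  Passage from the real to the scalar field: over \<open>\<complex>\<close>, a real functional \<open>g\<close> is the real part of the
  linear functional \<open>u \<mapsto> g u - i g (i u)\<close>, and the norm does not grow because every value \<open>f u\<close> can be rotated to
  the positive real axis.
\<close>

lemma norming_functional:
  fixes sF :: "'k :: real_or_complex \<Rightarrow> 'f :: banach \<Rightarrow> 'f"
  assumes "banach_space_over sF"
  shows "\<exists>f. (\<forall>x y. f (x + y) = f x + f y) \<and> (\<forall>c x. f (sF c x) = c * f x) \<and>
    (\<forall>x. norm (f x) \<le> norm x) \<and> norm y \<le> norm (f y)"
proof -
  interpret banach_space_over sF by fact
  obtain h :: "'k \<Rightarrow> complex" where h: "\<And>a b. h (a + b) = h a + h b" "\<And>a b. h (a * b) = h a * h b"
    "\<And>a. norm (h a) = norm a" "\<And>a b. h (a - b) = h a - h b" "\<And>r. h (of_real r) = of_real r"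
    and range: "range h = UNIV \<or> range h = \<real>" and "inj h"
    using scalar_embedding[where 'k = 'k] by metis
  have h_inj: "a = b" if "h a = h b" for a b using \<open>inj h\<close> that by (rule injD)
  obtain g :: "'f \<Rightarrow> real" where "linear g" and g_le: "\<And>x. g x \<le> norm x" and g_y: "g y \<ge> norm y"
    using real_norming_functional by blast
  have g_add: "g (u + v) = g u + g v" and g_scale: "g (t *\<^sub>R u) = t * g u" for u v t
    using \<open>linear g\<close> by (auto simp: linear_add linear_scale)
  have g_minus: "g (- u) = - g u" for u using g_scale[of "-1" u] by simp
  have "\<exists>f. (\<forall>u v. f (u + v) = f u + f v) \<and> (\<forall>c u. f (sF c u) = c * f u) \<and>
    (\<forall>u. Re (h (f u)) = g u)"
    using range
  proof
    assume "range h = \<real>"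
    have real: "\<exists>r. c = of_real r" for c :: 'k
    proof -
      obtain r where "h c = of_real r" using \<open>range h = \<real>\<close> by (metis Reals_cases rangeI)
      then show ?thesis using h(5) by (metis h_inj)
    qed
    have "g (sF c u) = Re (h c) * g u" for c u
    proof -
      obtain r where "c = of_real r" using real by blast
      then show ?thesis by (simp add: scale_of_real g_scale h(5))
    qed
    moreover have "c = of_real (Re (h c))" for c :: 'k using real[of c] h(5) by auto
    ultimately show ?thesis
      by (intro exI[of _ "\<lambda>u. of_real (g u)"]) (auto simp: g_add h(5))
  next
    assume "range h = UNIV"
    then obtain i where i: "h i = \<i>" by (metis surjD)
    have c: "c = of_real (Re (h c)) + of_real (Im (h c)) * i" for c
      by (rule h_inj) (simp add: h(1,2,5) i complex_eq_iff)
    have ii: "i * i = - 1"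
      by (rule h_inj) (use h(4)[of 0 1] h(5)[of 0] h(5)[of 1] in \<open>simp add: h(2) i\<close>)
    define f where "f u = of_real (g u) - i * of_real (g (sF i u))" for u
    have add: "f (u + v) = f u + f v" for u v
      by (simp add: f_def g_add scale_right_distrib algebra_simps)
    have fr: "f (sF (of_real r) u) = of_real r * f u" for r u
    proof -
      have "sF i (r *\<^sub>R u) = r *\<^sub>R sF i u"
        using scale_left_commute[of i "of_real r" u] by (simp only: scale_of_real)
      then show ?thesis by (simp add: f_def scale_of_real g_scale algebra_simps)
    qed
    have "sF i (sF i u) = - u" for u by (simp add: ii scale_scale)
    then have fi: "f (sF i u) = i * f u" for u
      by (simp add: f_def g_minus right_diff_distrib ii flip: mult.assoc)
    have "f (sF c u) = c * f u" for c u
    proof -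
      have "f (sF c u) = f (sF (of_real (Re (h c))) u + sF (of_real (Im (h c))) (sF i u))"
        by (subst c[of c]) (simp only: scale_left_distrib scale_scale)
      also have "\<dots> = (of_real (Re (h c)) + of_real (Im (h c)) * i) * f u"
        by (simp only: add fr fi) (simp add: algebra_simps)
      finally show ?thesis by (subst (2) c[of c])
    qed
    moreover have "Re (h (f u)) = g u" for u by (simp add: f_def h i)
    ultimately show ?thesis using add by blast
  qed
  then obtain f where f: "\<And>u v. f (u + v) = f u + f v" "\<And>c u. f (sF c u) = c * f u"
    "\<And>u. Re (h (f u)) = g u"
    by blast
  have "norm (f u) \<le> norm u" for u
  proof (cases "f u = 0")
    case False
    define c where "c = of_real (norm (f u)) / f u"
    have c: "c * f u = of_real (norm (f u))" "norm c = 1"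
      using False by (auto simp: c_def norm_divide)
    then have "norm (f u) = Re (h (f (sF c u)))" by (simp add: f(2) h(5))
    also have "\<dots> \<le> norm (sF c u)" using g_le by (simp add: f(3))
    finally show ?thesis using c by (simp add: norm_scale)
  qed simp
  moreover have "norm y \<le> norm (f y)"
    using g_y f(3)[of y] complex_Re_le_cmod[of "h (f y)"] h(3)[of "f y"] by linarith
  ultimately show ?thesis using f by blast
qed

section \<open>Norms of functionals\<close>

text \<open>
  The part of the notion of a normed space that estimates for functionals use. It applies uniformly
  to Banach spaces, their duals and biduals, and spaces of polynomials, where only
  homogeneity and the sign of \<open>N\<close> matter for the definition of the operator norm.
\<close>

definition homogeneous_norm ::
    "('k :: real_or_complex \<Rightarrow> 'v :: ab_group_add \<Rightarrow> 'v) \<Rightarrow> ('v \<Rightarrow> real) \<Rightarrow> 'v set \<Rightarrow> bool"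
  where "homogeneous_norm s N X \<longleftrightarrow>
    0 \<in> X \<and> (\<forall>x\<in>X. 0 \<le> N x) \<and> (\<forall>c. \<forall>x\<in>X. s c x \<in> X \<and> N (s c x) = norm c * N x)"

lemma dualI:
  assumes "\<And>x. x \<notin> X \<Longrightarrow> f x = 0" "\<And>x y. x \<in> X \<Longrightarrow> y \<in> X \<Longrightarrow> f (x + y) = f x + f y"
    "\<And>c x. x \<in> X \<Longrightarrow> f (s c x) = c * f x" "\<And>x. x \<in> X \<Longrightarrow> norm (f x) \<le> C * N x"
  shows "f \<in> dual s N X"
  using assms unfolding dual_def by blast

lemma dual_add: "f \<in> dual s N X \<Longrightarrow> x \<in> X \<Longrightarrow> y \<in> X \<Longrightarrow> f (x + y) = f x + f y"
  and dual_scale: "f \<in> dual s N X \<Longrightarrow> x \<in> X \<Longrightarrow> f (s c x) = c * f x"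
  and dual_outside: "f \<in> dual s N X \<Longrightarrow> x \<notin> X \<Longrightarrow> f x = 0"
  by (auto simp: dual_def)

lemma norm_le_dual_norm:
  assumes N: "homogeneous_norm s N X" and f: "f \<in> dual s N X" and x: "x \<in> X"
  shows "norm (f x) \<le> dual_norm N X f * N x"
proof -
  obtain C where "\<forall>x\<in>X. norm (f x) \<le> C * N x"
    using f unfolding dual_def by blast
  then have C: "norm (f x) \<le> C * N x" if "x \<in> X" for x using that by blast
  have bdd: "bdd_above ((\<lambda>x. norm (f x)) ` {x \<in> X. N x \<le> 1})"
  proof (rule bdd_aboveI2)
    fix x assume x: "x \<in> {x \<in> X. N x \<le> 1}"
    have "norm (f x) \<le> C * N x" using C x by auto
    also have "\<dots> \<le> \<bar>C\<bar> * N x" using N x by (intro mult_right_mono) (auto simp: homogeneous_norm_def)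
    also have "\<dots> \<le> \<bar>C\<bar> * 1" using x by (intro mult_left_mono) auto
    finally show "norm (f x) \<le> \<bar>C\<bar>" by simp
  qed
  show ?thesis
  proof (cases "N x = 0")
    case True
    then show ?thesis using C[OF x] by simp
  next
    case False
    then have pos: "N x > 0" using N x by (auto simp: homogeneous_norm_def less_le)
    let ?y = "s (of_real (1 / N x)) x"
    have "?y \<in> {x \<in> X. N x \<le> 1}" using N x pos by (auto simp: homogeneous_norm_def norm_divide)
    then have "norm (f ?y) \<le> dual_norm N X f"
      unfolding dual_norm_def by (intro cSUP_upper bdd)
    moreover have "norm (f ?y) = norm (f x) / N x"
      using pos by (simp only: dual_scale[OF f x]) (simp add: norm_mult norm_divide)
    ultimately have "norm (f x) / N x \<le> dual_norm N X f" by (simp only:)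
    then show ?thesis using pos by (simp add: pos_divide_le_eq)
  qed
qed

lemma dual_norm_le:
  assumes "homogeneous_norm s N X" and "C \<ge> 0" and "\<And>x. x \<in> X \<Longrightarrow> norm (f x) \<le> C * N x"
  shows "dual_norm N X f \<le> C"
  unfolding dual_norm_def
proof (rule cSUP_least)
  show "{x \<in> X. N x \<le> 1} \<noteq> {}"
  proof -
    have "s 0 0 \<in> X" "N (s 0 0) = 0" using assms(1) by (auto simp: homogeneous_norm_def)
    then show ?thesis by force
  qed
  fix x assume x: "x \<in> {x \<in> X. N x \<le> 1}"
  then have "norm (f x) \<le> C * N x" using assms by auto
  also have "\<dots> \<le> C * 1" using x assms(2) by (intro mult_left_mono) auto
  finally show "norm (f x) \<le> C" by simp
qed

lemma dual_norm_nonneg: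
  assumes N: "homogeneous_norm s N X" and f: "f \<in> dual s N X"
  shows "dual_norm N X f \<ge> 0"
proof -
  obtain C where "\<forall>x\<in>X. norm (f x) \<le> C * N x"
    using f unfolding dual_def by blast
  then have C: "norm (f x) \<le> C * N x" if "x \<in> X" for x using that by blast
  show ?thesis
  proof (cases "\<exists>x\<in>X. N x > 0")
    case True
    then obtain x where "x \<in> X" "N x > 0" by blast
    then show ?thesis using norm_le_dual_norm[OF N f, of x] norm_ge_zero[of "f x"]
      by (meson order_trans zero_le_mult_iff linorder_not_le)
  next
    case False
    then have N0: "N x = 0" if "x \<in> X" for x
      using N that unfolding homogeneous_norm_def by (meson antisym linorder_not_le)
    then have "(\<lambda>x. norm (f x)) ` {x \<in> X. N x \<le> 1} = {0}"
      using C N N0 by (force simp: homogeneous_norm_def)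
    then show ?thesis by (simp add: dual_norm_def)
  qed
qed

lemma dual_norm_restrict_le:
  assumes "homogeneous_norm s N X" "homogeneous_norm s N J" "J \<subseteq> X" "f \<in> dual s N X"
    and "\<And>x. x \<in> J \<Longrightarrow> g x = f x"
  shows "dual_norm N J g \<le> dual_norm N X f"
  using assms norm_le_dual_norm[OF assms(1,4)]
  by (intro dual_norm_le[OF assms(2)] dual_norm_nonneg[OF assms(1,4)]) auto

lemma homogeneous_norm_subset:
  "homogeneous_norm s N X \<Longrightarrow> J \<subseteq> X \<Longrightarrow> 0 \<in> J \<Longrightarrow> (\<And>c x. x \<in> J \<Longrightarrow> s c x \<in> J) \<Longrightarrow>
    homogeneous_norm s N J"
  unfolding homogeneous_norm_def by blast

text \<open>
  The construction of the dual can be iterated, which is how the bidual arises.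
\<close>

lemma homogeneous_norm_dual:
  assumes N: "homogeneous_norm s N X"
  shows "homogeneous_norm (fun_scale (*)) (dual_norm N X) (dual s N X)"
proof -
  have scale: "fun_scale (*) c f \<in> dual s N X" if f: "f \<in> dual s N X" for c f
  proof -
    obtain C where "\<forall>x\<in>X. norm (f x) \<le> C * N x"
      using f unfolding dual_def by blast
    then have C: "norm (f x) \<le> C * N x" if "x \<in> X" for x using that by blast
    show ?thesis
    proof (rule dualI)
      show "norm (fun_scale (*) c f x) \<le> (norm c * C) * N x" if "x \<in> X" for x
        using mult_left_mono[OF C[OF that], of "norm c"] by (simp add: fun_scale_def norm_mult mult.assoc)
    qed (use f in \<open>auto simp: fun_scale_def dual_def algebra_simps\<close>)
  qed
  have le: "dual_norm N X (fun_scale (*) c f) \<le> norm c * dual_norm N X f" if f: "f \<in> dual s N X" for c f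
  proof (rule dual_norm_le[OF N])
    show "0 \<le> norm c * dual_norm N X f" using dual_norm_nonneg[OF N f] by simp
    show "norm (fun_scale (*) c f x) \<le> norm c * dual_norm N X f * N x" if "x \<in> X" for x
      using mult_left_mono[OF norm_le_dual_norm[OF N f that], of "norm c"]
      by (simp add: fun_scale_def norm_mult mult.assoc)
  qed
  have "norm c * dual_norm N X f \<le> dual_norm N X (fun_scale (*) c f)" if f: "f \<in> dual s N X" for c f
  proof (cases "c = 0")
    case True
    then show ?thesis using dual_norm_nonneg[OF N scale[OF f]] by simp
  next
    case False
    then have "fun_scale (*) (inverse c) (fun_scale (*) c f) = f"
      by (auto simp: fun_scale_def)
    then have "dual_norm N X f \<le> norm (inverse c) * dual_norm N X (fun_scale (*) c f)"
      using le[OF scale[OF f], of "inverse c" c] by simp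
    then have "norm c * dual_norm N X f
        \<le> norm c * (norm (inverse c) * dual_norm N X (fun_scale (*) c f))"
      by (intro mult_left_mono) auto
    also have "\<dots> = norm (c * inverse c) * dual_norm N X (fun_scale (*) c f)"
      by (simp only: norm_mult mult.assoc)
    finally show ?thesis using False by simp
  qed
  with le have "dual_norm N X (fun_scale (*) c f) = norm c * dual_norm N X f" if "f \<in> dual s N X" for c f
    using that by (simp add: antisym)
  moreover have "0 \<in> dual s N X" by (rule dualI[where C = 0]) auto
  ultimately show ?thesis
    using scale dual_norm_nonneg[OF N] by (simp add: homogeneous_norm_def)
qed

lemma dual_closed_add:
  assumes "f \<in> dual s N X" "g \<in> dual s N X"
  shows "f + g \<in> dual s N X"
proof -
  obtain C D where CD: "\<forall>x\<in>X. norm (f x) \<le> C * N x" "\<forall>x\<in>X. norm (g x) \<le> D * N x"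
    using assms unfolding dual_def by blast
  show ?thesis
  proof (rule dualI)
    show "norm ((f + g) x) \<le> (C + D) * N x" if "x \<in> X" for x
      using norm_triangle_ineq[of "f x" "g x"] bspec[OF CD(1) that] bspec[OF CD(2) that] by (simp add: algebra_simps)
  qed (use assms in \<open>auto simp: dual_def algebra_simps\<close>)
qed

lemma homogeneous_norm_UNIV: "banach_space_over s \<Longrightarrow> homogeneous_norm s norm UNIV"
  by (simp add: homogeneous_norm_def banach_space_over.norm_scale)

lemma homogeneous_norm_dual_space:
  "banach_space_over s \<Longrightarrow> homogeneous_norm (fun_scale (*)) dual_space_norm (dual_space s)"
  by (intro homogeneous_norm_dual homogeneous_norm_UNIV)

lemma homogeneous_norm_bidual:
  "banach_space_over s \<Longrightarrow> homogeneous_norm (fun_scale (*)) (bidual_norm s) (bidual s)"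
  unfolding bidual_def bidual_norm_def
  by (intro homogeneous_norm_dual homogeneous_norm_dual_space)

lemma dual_space_add: "\<phi> \<in> dual_space s \<Longrightarrow> \<phi> (u + v) = \<phi> u + \<phi> v"
  and dual_space_scale: "\<phi> \<in> dual_space s \<Longrightarrow> \<phi> (s c u) = c * \<phi> u"
  by (auto simp: dual_def)

context
  fixes sE :: "'k :: real_or_complex \<Rightarrow> 'e :: banach \<Rightarrow> 'e"
  assumes E: "banach_space_over sE"
begin

lemma dual_space_bound: "\<phi> \<in> dual_space sE \<Longrightarrow> norm (\<phi> x) \<le> dual_space_norm \<phi> * norm x"
  by (rule norm_le_dual_norm[OF homogeneous_norm_UNIV[OF E]]) auto

lemma bounded_linear_dual_space:
  assumes "\<phi> \<in> dual_space sE"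
  shows "bounded_linear \<phi>"
proof (rule bounded_linear_intro[where K = "dual_space_norm \<phi>"])
  show "\<phi> (r *\<^sub>R x) = r *\<^sub>R \<phi> x" for r x
    using dual_space_scale[OF assms, of "of_real r" x] banach_space_over.scale_of_real[OF E]
    by (simp add: scaleR_conv_of_real)
qed (use dual_space_add[OF assms] dual_space_bound[OF assms] in \<open>auto simp: mult.commute\<close>)

lemma dual_space_diff: "\<phi> \<in> dual_space sE \<Longrightarrow> \<phi> (u - v) = \<phi> u - \<phi> v"
  by (simp add: bounded_linear_dual_space linear_diff bounded_linear.linear)

lemma fun_scale_dual_space: "\<phi> \<in> dual_space sE \<Longrightarrow> fun_scale (*) c \<phi> \<in> dual_space sE"
  using homogeneous_norm_dual_space[OF E] by (simp add: homogeneous_norm_def)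

lemma bidualI:
  assumes "\<And>\<phi>. \<phi> \<notin> dual_space sE \<Longrightarrow> z \<phi> = 0"
    "\<And>\<phi> \<psi>. \<phi> \<in> dual_space sE \<Longrightarrow> \<psi> \<in> dual_space sE \<Longrightarrow> z (\<phi> + \<psi>) = z \<phi> + z \<psi>"
    "\<And>c \<phi>. \<phi> \<in> dual_space sE \<Longrightarrow> z (fun_scale (*) c \<phi>) = c * z \<phi>"
    "\<And>\<phi>. \<phi> \<in> dual_space sE \<Longrightarrow> norm (z \<phi>) \<le> C * dual_space_norm \<phi>" "C \<ge> 0"
  shows "z \<in> bidual sE" "bidual_norm sE z \<le> C"
proof -
  show "z \<in> bidual sE" unfolding bidual_def by (rule dualI) (use assms in auto)
  show "bidual_norm sE z \<le> C" unfolding bidual_norm_def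
    by (rule dual_norm_le[OF homogeneous_norm_dual_space[OF E]]) (use assms in auto)
qed

end

section \<open>Goldstine's theorem\<close>

lemma scalar_conj:
  fixes h :: "'k :: real_or_complex \<Rightarrow> complex"
  assumes "range h = UNIV \<or> range h = \<real>"
  shows "\<exists>c. h c = cnj (h a)"
proof -
  have "cnj (h a) \<in> range h" using assms
  proof
    assume r: "range h = \<real>"
    then have "h a \<in> \<real>" by blast
    then show ?thesis by (metis Reals_cnj_iff rangeI)
  qed simp
  then show ?thesis by (metis imageE)
qed

lemma dual_sum:
  assumes "finite S" "\<And>i. i \<in> S \<Longrightarrow> F i \<in> dual s N X" "f \<in> dual (fun_scale (*)) M (dual s N X)"
    and N: "homogeneous_norm s N X"
  shows "(\<lambda>x. \<Sum>i\<in>S. c i * F i x) \<in> dual s N X \<and> f (\<lambda>x. \<Sum>i\<in>S. c i * F i x) = (\<Sum>i\<in>S. c i * f (F i))"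
  using assms(1,2)
proof (induction S)
  case empty
  have H: "homogeneous_norm (fun_scale (*)) (dual_norm N X) (dual s N X)"
    by (rule homogeneous_norm_dual[OF N])
  then have "(\<lambda>x. 0) \<in> dual s N X" by (simp add: homogeneous_norm_def zero_fun_def)
  moreover from dual_scale[OF assms(3) this, of 0] have "f (\<lambda>x. 0) = 0"
    by (simp add: fun_scale_def)
  ultimately show ?case by simp
next
  case (insert i S)
  have H: "homogeneous_norm (fun_scale (*)) (dual_norm N X) (dual s N X)"
    by (rule homogeneous_norm_dual[OF N])
  let ?g = "\<lambda>x. \<Sum>i\<in>S. c i * F i x"
  have eq: "(\<lambda>x. \<Sum>i\<in>insert i S. c i * F i x) = fun_scale (*) (c i) (F i) + ?g"
    using insert.hyps by (auto simp: fun_scale_def plus_fun_def)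
  have g: "?g \<in> dual s N X" "f ?g = (\<Sum>i\<in>S. c i * f (F i))" using insert by auto
  have Fi: "F i \<in> dual s N X" using insert.prems by simp
  then have cF: "fun_scale (*) (c i) (F i) \<in> dual s N X" using H by (simp add: homogeneous_norm_def)
  show ?case
    unfolding eq using insert.hyps g Fi cF dual_add[OF assms(3) cF g(1)] dual_scale[OF assms(3) Fi]
    by (simp add: dual_closed_add)
qed

text \<open>
  The finite-dimensional core of Goldstine's theorem, by a variational argument instead of a
  separation theorem. Let \<open>q x\<close> be the squared distance of the vectors \<open>(\<phi> x)\<close> and \<open>(\<Xi> \<phi>)\<close>, \<open>\<phi> \<in> S\<close>, and \<open>d\<close> its
  infimum over the ball of radius \<open>r = \<parallel>\<Xi>\<parallel>\<close>. If \<open>d > 0\<close>, take \<open>x\<close> almost minimising \<open>q\<close> and let \<open>\<psi>\<close>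
  be the combination of the \<open>\<phi> \<in> S\<close> with coefficients the conjugates of \<open>\<phi> x - \<Xi> \<phi>\<close>, which
  represents half the derivative of \<open>q\<close> at \<open>x\<close>. Moving from \<open>x\<close> towards any \<open>y\<close> in the ball hardly
  decreases \<open>q\<close>, so \<open>Re \<psi> x\<close> is almost the infimum \<open>- r \<parallel>\<psi>\<parallel>\<close> of \<open>Re \<psi>\<close> on the ball. But
  \<open>Re \<Xi> \<psi> = Re \<psi> x - q x \<le> Re \<psi> x - d\<close>, which would be less than \<open>- \<parallel>\<Xi>\<parallel> \<parallel>\<psi>\<parallel>\<close>.
\<close>

lemma Helly_approximation:
  fixes sE :: "'k :: real_or_complex \<Rightarrow> 'e :: banach \<Rightarrow> 'e"
  assumes E: "banach_space_over sE" and \<Xi>: "\<Xi> \<in> bidual sE"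
    and S: "finite S" "S \<subseteq> dual_space sE" and e: "e > 0"
  shows "\<exists>x. norm x \<le> bidual_norm sE \<Xi> \<and> (\<forall>\<phi>\<in>S. norm (\<phi> x - \<Xi> \<phi>) < e)"
proof (rule ccontr)
  assume contr: "\<not> ?thesis"
  interpret banach_space_over sE by fact
  note HE = homogeneous_norm_UNIV[OF E]
  note HD = homogeneous_norm_dual_space[OF E]
  have \<Xi>': "\<Xi> \<in> dual (fun_scale (*)) dual_space_norm (dual_space sE)"
    using \<Xi> by (simp add: bidual_def)
  obtain h :: "'k \<Rightarrow> complex" where h: "\<And>a b. h (a + b) = h a + h b" "\<And>a b. h (a * b) = h a * h b"
    "\<And>a. norm (h a) = norm a" "\<And>a b. h (a - b) = h a - h b" "\<And>r. h (of_real r) = of_real r"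
    and range: "range h = UNIV \<or> range h = \<real>"
    using scalar_embedding[where 'k = 'k] by metis
  have "\<forall>a. \<exists>c. h c = cnj (h a)" using scalar_conj[OF range] ..
  from choice[OF this] obtain conj where conj: "\<And>a. h (conj a) = cnj (h a)" by blast
  have h_sum: "h (\<Sum>i\<in>S. F i) = (\<Sum>i\<in>S. h (F i))" for F :: "('e \<Rightarrow> 'k) \<Rightarrow> 'k"
    using S(1) h(1) h(5)[of 0] by (induction S) auto
  define r where "r = bidual_norm sE \<Xi>"
  have r: "r \<ge> 0" unfolding r_def bidual_norm_def by (rule dual_norm_nonneg[OF HD \<Xi>'])
  define q where "q x = (\<Sum>\<phi>\<in>S. (norm (\<phi> x - \<Xi> \<phi>))\<^sup>2)" for x
  define d where "d = (INF x\<in>cball 0 r. q x)"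
  have bdd: "bdd_below (q ` cball 0 r)"
    by (intro bdd_belowI2[of _ 0]) (simp add: q_def sum_nonneg)
  have d_le: "d \<le> q x" if "norm x \<le> r" for x
    unfolding d_def using that by (intro cINF_lower bdd) simp
  have "e\<^sup>2 \<le> q x" if x: "norm x \<le> r" for x
  proof -
    obtain \<phi> where \<phi>: "\<phi> \<in> S" "e \<le> norm (\<phi> x - \<Xi> \<phi>)"
      using contr x unfolding r_def by (meson linorder_not_le)
    have "e\<^sup>2 \<le> (norm (\<phi> x - \<Xi> \<phi>))\<^sup>2" using \<phi> e by (intro power_mono) auto
    also have "\<dots> \<le> q x" unfolding q_def using S \<phi> by (intro member_le_sum) auto
    finally show ?thesis .
  qed
  then have "e\<^sup>2 \<le> d" unfolding d_def using r by (intro cINF_greatest) auto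
  then have d: "d > 0" using e by (meson less_le_trans zero_less_power)
  define M where "M = (\<Sum>\<phi>\<in>S. (dual_space_norm \<phi> * (2 * r))\<^sup>2)"
  have M: "M \<ge> 0" by (simp add: M_def sum_nonneg)
  \<comment> \<open>The step length. With \<open>q x < d + t\<^sup>2\<close> the first-order estimate below has the error
    \<open>t (1 + M) / 2\<close>, and this choice makes it smaller than \<open>d\<close>.\<close>
  define t where "t = min 1 (d / (1 + M))"
  have "t \<le> d / (1 + M)" by (simp add: t_def)
  then have "t * (1 + M) \<le> d" using M by (simp add: pos_le_divide_eq)
  moreover have "t > 0" "t \<le> 1" using d M by (auto simp: t_def)
  ultimately have t: "t > 0" "t \<le> 1" "t * (1 + M) \<le> d" by auto
  have "d < d + t\<^sup>2" using t by simp
  then obtain x where x: "norm x \<le> r" "q x < d + t\<^sup>2"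
    using cINF_less_iff[OF _ bdd, of "d + t\<^sup>2"] r unfolding d_def[symmetric] by auto
  define \<psi> where "\<psi> v = (\<Sum>\<phi>\<in>S. conj (\<phi> x - \<Xi> \<phi>) * \<phi> v)" for v
  have \<psi>: "\<psi> \<in> dual_space sE" "\<Xi> \<psi> = (\<Sum>\<phi>\<in>S. conj (\<phi> x - \<Xi> \<phi>) * \<Xi> \<phi>)"
    unfolding \<psi>_def using dual_sum[OF S(1) _ \<Xi>' HE, of "\<lambda>\<phi>. \<phi>" "\<lambda>\<phi>. conj (\<phi> x - \<Xi> \<phi>)"] S(2)
    by auto
  have \<psi>_add: "\<psi> (u + v) = \<psi> u + \<psi> v" and \<psi>_scale: "\<psi> (sE c u) = c * \<psi> u" for u v c
    using \<psi>(1) by (auto simp: dual_def)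
  have variation: "Re (h (\<psi> x)) - t * (1 + M) / 2 \<le> Re (h (\<psi> y))" if y: "norm y \<le> r" for y
  proof -
    define z where "z = x + sE (of_real t) (y - x)"
    have "z = (1 - t) *\<^sub>R x + t *\<^sub>R y" by (simp add: z_def scale_of_real algebra_simps)
    then have "norm z \<le> (1 - t) * norm x + t * norm y"
      using t norm_triangle_ineq[of "(1 - t) *\<^sub>R x" "t *\<^sub>R y"] by simp
    also have "\<dots> \<le> (1 - t) * r + t * r" using t x y by (intro add_mono mult_left_mono) auto
    finally have "norm z \<le> r" by (simp add: algebra_simps)
    have "(norm (\<phi> z - \<Xi> \<phi>))\<^sup>2 \<le> (norm (\<phi> x - \<Xi> \<phi>))\<^sup>2
      + 2 * t * Re (h (conj (\<phi> x - \<Xi> \<phi>) * \<phi> (y - x))) + t\<^sup>2 * (dual_space_norm \<phi> * (2 * r))\<^sup>2"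
      if "\<phi> \<in> S" for \<phi>
    proof -
      have \<phi>: "\<phi> \<in> dual_space sE" using that S by blast
      then have "\<phi> z - \<Xi> \<phi> = (\<phi> x - \<Xi> \<phi>) + of_real t * \<phi> (y - x)"
        unfolding z_def by (simp add: dual_def)
      then have "(norm (\<phi> z - \<Xi> \<phi>))\<^sup>2 = (cmod (h (\<phi> x - \<Xi> \<phi>) + of_real t * h (\<phi> (y - x))))\<^sup>2"
        by (simp only: h(1,2,5) flip: h(3))
      also have "\<dots> = (cmod (h (\<phi> x - \<Xi> \<phi>)))\<^sup>2 + 2 * t * Re (h (conj (\<phi> x - \<Xi> \<phi>) * \<phi> (y - x)))
        + t\<^sup>2 * (cmod (h (\<phi> (y - x))))\<^sup>2"
        unfolding cmod_power2 h(2) conj by (simp add: power2_eq_square algebra_simps)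
      finally have eq: "(norm (\<phi> z - \<Xi> \<phi>))\<^sup>2 = (norm (\<phi> x - \<Xi> \<phi>))\<^sup>2
        + 2 * t * Re (h (conj (\<phi> x - \<Xi> \<phi>) * \<phi> (y - x))) + t\<^sup>2 * (norm (\<phi> (y - x)))\<^sup>2"
        unfolding h(3) .
      have "norm (\<phi> (y - x)) \<le> dual_space_norm \<phi> * norm (y - x)"
        by (rule norm_le_dual_norm[OF HE \<phi>]) simp
      also have "\<dots> \<le> dual_space_norm \<phi> * (2 * r)"
        using x y norm_triangle_ineq4[of y x] by (intro mult_left_mono dual_norm_nonneg[OF HE \<phi>]) auto
      finally have "t\<^sup>2 * (norm (\<phi> (y - x)))\<^sup>2 \<le> t\<^sup>2 * (dual_space_norm \<phi> * (2 * r))\<^sup>2"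
        by (intro mult_left_mono power_mono) auto
      with eq show ?thesis by simp
    qed
    then have "q z \<le> (\<Sum>\<phi>\<in>S. (norm (\<phi> x - \<Xi> \<phi>))\<^sup>2
      + 2 * t * Re (h (conj (\<phi> x - \<Xi> \<phi>) * \<phi> (y - x))) + t\<^sup>2 * (dual_space_norm \<phi> * (2 * r))\<^sup>2)"
      unfolding q_def by (rule sum_mono)
    also have "\<dots> = q x + 2 * t * Re (h (\<psi> (y - x))) + t\<^sup>2 * M"
      by (simp add: q_def \<psi>_def M_def sum.distrib h_sum sum_distrib_left)
    also have "h (\<psi> (y - x)) = h (\<psi> y) - h (\<psi> x)"
      using \<psi>_add[of "y - x" x] by (simp add: h(1))
    finally have "d \<le> d + t\<^sup>2 + 2 * t * (Re (h (\<psi> y)) - Re (h (\<psi> x))) + t\<^sup>2 * M"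
      using d_le[OF \<open>norm z \<le> r\<close>] x(2) by simp
    then have "0 \<le> t * (t * (1 + M) + 2 * (Re (h (\<psi> y)) - Re (h (\<psi> x))))"
      by (simp add: power2_eq_square algebra_simps)
    then have "0 \<le> t * (1 + M) + 2 * (Re (h (\<psi> y)) - Re (h (\<psi> x)))"
      using t(1) by (simp add: zero_le_mult_iff)
    then show ?thesis by simp
  qed
  define b where "b = t * (1 + M) / 2 - Re (h (\<psi> x))"
  have \<psi>_le: "norm (\<psi> y) \<le> b" if y: "norm y \<le> r" for y
  proof (cases "\<psi> y = 0")
    case True
    then show ?thesis using variation[OF y] h(3)[of "\<psi> y"] by (simp add: b_def)
  next
    case False
    \<comment> \<open>Rotate \<open>y\<close> so that \<open>\<psi>\<close> takes the value \<open>- \<bar>\<psi> y\<bar>\<close>; the ball is invariant under rotations.\<close>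
    define c where "c = - of_real (norm (\<psi> y)) / \<psi> y"
    have c: "c * \<psi> y = of_real (- norm (\<psi> y))" "norm c = 1"
      using False by (auto simp: c_def norm_divide)
    have "norm (sE c y) \<le> r" using c y by (simp add: norm_scale)
    from variation[OF this] show ?thesis unfolding \<psi>_scale c(1) h(5) b_def by simp
  qed
  have b: "b \<ge> 0" using order_trans[OF norm_ge_zero \<psi>_le[of 0]] r by simp
  have "r * dual_space_norm \<psi> \<le> b"
  proof (cases "r = 0")
    case True
    then show ?thesis using b by simp
  next
    case False
    have "dual_space_norm \<psi> \<le> b / r"
      unfolding dual_norm_def
    proof (rule cSUP_least)
      fix v :: 'e assume "v \<in> {x \<in> UNIV. norm x \<le> 1}"
      then have "norm (sE (of_real r) v) \<le> r" using r by (simp add: norm_scale mult_left_le)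
      from \<psi>_le[OF this] show "norm (\<psi> v) \<le> b / r"
        using r False by (simp add: \<psi>_scale norm_mult field_simps)
    qed (auto intro: exI[of _ 0])
    then show ?thesis using r False by (simp add: field_simps)
  qed
  moreover have "norm (\<Xi> \<psi>) \<le> r * dual_space_norm \<psi>"
    unfolding r_def bidual_norm_def by (rule norm_le_dual_norm[OF HD \<Xi>' \<psi>(1)])
  moreover have "- Re (h (\<Xi> \<psi>)) \<le> norm (\<Xi> \<psi>)"
    using abs_Re_le_cmod[of "h (\<Xi> \<psi>)"] h(3) by simp
  moreover have "Re (h (\<psi> x)) - Re (h (\<Xi> \<psi>)) = q x"
  proof -
    have "Re (h (\<psi> x)) - Re (h (\<Xi> \<psi>)) = (\<Sum>\<phi>\<in>S. Re (h (conj (\<phi> x - \<Xi> \<phi>) * (\<phi> x - \<Xi> \<phi>))))"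
    proof -
      have "\<psi> x - \<Xi> \<psi> = (\<Sum>\<phi>\<in>S. conj (\<phi> x - \<Xi> \<phi>) * (\<phi> x - \<Xi> \<phi>))"
        by (simp only: \<psi>(2) \<psi>_def right_diff_distrib sum_subtractf)
      then have "h (\<psi> x) - h (\<Xi> \<psi>) = (\<Sum>\<phi>\<in>S. h (conj (\<phi> x - \<Xi> \<phi>) * (\<phi> x - \<Xi> \<phi>)))"
        by (simp only: h_sum flip: h(4))
      then show ?thesis by (simp only: Re_sum flip: minus_complex.sel)
    qed
    also have "\<dots> = q x"
      unfolding q_def
    proof (rule sum.cong[OF refl])
      fix \<phi>
      show "Re (h (conj (\<phi> x - \<Xi> \<phi>) * (\<phi> x - \<Xi> \<phi>))) = (norm (\<phi> x - \<Xi> \<phi>))\<^sup>2"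
        unfolding h(2) conj h(3)[symmetric] cmod_power2 by (simp add: power2_eq_square)
    qed
    finally show ?thesis .
  qed
  ultimately have "q x \<le> t * (1 + M) / 2" by (simp add: b_def)
  with d_le[OF x(1)] t(3) d show False by simp
qed

text \<open>
  The sets of approximants of \<open>Helly_approximation\<close> generate a proper filter, which converges
  weak* to \<open>\<Xi>\<close>; an ultrafilter below it is convenient because all bounded scalar functions have
  limits along it. The radius is exactly the norm of \<open>\<Xi>\<close>: the comparison of norms in
  \<open>extension_to_bidual_unique\<close> depends on this.
\<close>

theorem Goldstine:
  fixes sE :: "'k :: real_or_complex \<Rightarrow> 'e :: banach \<Rightarrow> 'e"
  assumes E: "banach_space_over sE" and \<Xi>: "\<Xi> \<in> bidual sE"
  shows "\<exists>U. ultrafilter U \<and> (\<forall>\<^sub>F x in U. norm x \<le> bidual_norm sE \<Xi>) \<and>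
    (\<forall>\<phi>\<in>dual_space sE. (\<phi> \<longlongrightarrow> \<Xi> \<phi>) U)"
proof -
  define A where "A = (\<lambda>(S, e). {x. norm x \<le> bidual_norm sE \<Xi> \<and> (\<forall>\<phi>\<in>S. norm (\<phi> x - \<Xi> \<phi>) < e)})"
  define I where "I = {S. finite S \<and> S \<subseteq> dual_space sE} \<times> {e :: real. e > 0}"
  define F where "F = (INF i\<in>I. principal (A i))"
  have F: "eventually P F \<longleftrightarrow> (\<exists>i\<in>I. \<forall>x\<in>A i. P x)" for P
    unfolding F_def
  proof (subst eventually_INF_base)
    have "({}, 1) \<in> I" by (simp add: I_def)
    then show "I \<noteq> {}" by blast
    fix i j assume "i \<in> I" "j \<in> I"
    then show "\<exists>k\<in>I. principal (A k) \<le> inf (principal (A i)) (principal (A j))"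
      by (intro bexI[of _ "(fst i \<union> fst j, min (snd i) (snd j))"])
        (auto simp: A_def I_def split: prod.splits)
  qed (simp add: eventually_principal)
  have "A i \<noteq> {}" if "i \<in> I" for i
    using that Helly_approximation[OF E \<Xi>] by (force simp: A_def I_def)
  then have "F \<noteq> bot" unfolding trivial_limit_def F by blast
  then obtain U where U: "ultrafilter U" "U \<le> F" by (rule ex_ultrafilter_le)
  have "\<forall>\<^sub>F x in F. norm x \<le> bidual_norm sE \<Xi>"
    unfolding F by (intro bexI[of _ "({}, 1)"]) (auto simp: A_def I_def)
  moreover have "(\<phi> \<longlongrightarrow> \<Xi> \<phi>) F" if "\<phi> \<in> dual_space sE" for \<phi>
    unfolding tendsto_iff dist_norm
  proof (intro allI impI)
    fix e :: real assume "e > 0"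
    with that show "\<forall>\<^sub>F x in F. norm (\<phi> x - \<Xi> \<phi>) < e"
      unfolding F by (intro bexI[of _ "({\<phi>}, e)"]) (auto simp: A_def I_def)
  qed
  ultimately show ?thesis
    using U by (intro exI[of _ U]) (auto dest: filter_leD intro: tendsto_mono)
qed

section \<open>Homogeneous polynomials\<close>

lemma linear_iff_over:
  assumes "banach_space_over s1" "banach_space_over s2"
  shows "Vector_Spaces.linear s1 s2 f \<longleftrightarrow>
    (\<forall>u v. f (u + v) = f u + f v) \<and> (\<forall>c u. f (s1 c u) = s2 c (f u))"
proof -
  have "vector_space s1" "vector_space s2"
    using assms by (auto simp: banach_space_over_def)
  then show ?thesis
    by (simp add: linear_iff_module_hom module_hom_iff module_iff_vector_space)
qed

lemma bounded_linear_scale: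
  assumes "banach_space_over s"
  shows "bounded_linear (s c)"
proof -
  interpret banach_space_over s by fact
  show ?thesis
  proof (rule bounded_linear_intro[where K = "norm c"])
    show "s c (r *\<^sub>R x) = r *\<^sub>R s c x" for r x
      using scale_left_commute[of c "of_real r" x] by (simp only: scale_of_real)
  qed (simp_all add: scale_right_distrib norm_scale mult.commute)
qed

lemma bounded_linear_scale_left:
  assumes "banach_space_over s"
  shows "bounded_linear (\<lambda>c. s c x)"
proof -
  interpret banach_space_over s by fact
  show ?thesis
  proof (rule bounded_linear_intro[where K = "norm x"])
    show "s (r *\<^sub>R c) x = r *\<^sub>R s c x" for r c
      by (simp add: scaleR_conv_of_real scale_of_real flip: scale_scale)
  qed (simp_all add: scale_left_distrib norm_scale)
qed

lemma tendsto_scale: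
  assumes "banach_space_over s" "(f \<longlongrightarrow> c) G" "(g \<longlongrightarrow> x) G"
  shows "((\<lambda>i. s (f i) (g i)) \<longlongrightarrow> s c x) G"
proof -
  interpret banach_space_over s by fact
  have "bounded_bilinear s"
  proof
    show "\<exists>K. \<forall>a b. norm (s a b) \<le> norm a * norm b * K" by (intro exI[of _ 1]) (simp add: norm_scale)
    show "s (r *\<^sub>R a) b = r *\<^sub>R s a b" for r a b
      by (simp add: scaleR_conv_of_real scale_of_real flip: scale_scale)
    show "s a (r *\<^sub>R b) = r *\<^sub>R s a b" for r a b
      using scale_left_commute[of a "of_real r" b] by (simp only: scale_of_real)
  qed (simp_all add: scale_left_distrib scale_right_distrib)
  then show ?thesis by (rule bounded_bilinear.tendsto) (fact assms)+
qed

lemma multilinear_iff: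
  "multilinear sE sF n A \<longleftrightarrow>
    (\<forall>as bs. length as + length bs + 1 = n \<longrightarrow> Vector_Spaces.linear sE sF (\<lambda>u. A (as @ u # bs)))"
  (is "?L \<longleftrightarrow> ?R")
proof
  assume L: ?L
  show ?R
  proof (intro allI impI)
    fix as bs :: "'b list" assume "length as + length bs + 1 = n"
    then have "length (as @ 0 # bs) = n" "length as < n" by auto
    with L have "Vector_Spaces.linear sE sF (\<lambda>u. A ((as @ 0 # bs)[length as := u]))"
      unfolding multilinear_def by blast
    then show "Vector_Spaces.linear sE sF (\<lambda>u. A (as @ u # bs))" by simp
  qed
next
  assume R: ?R
  show ?L unfolding multilinear_def
  proof (intro allI impI)
    fix xs :: "'b list" and i assume "length xs = n" "i < n"
    then have "Vector_Spaces.linear sE sF (\<lambda>u. A (take i xs @ u # drop (Suc i) xs))"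
      by (intro R[rule_format]) auto
    then show "Vector_Spaces.linear sE sF (\<lambda>u. A (xs[i := u]))"
      using \<open>length xs = n\<close> \<open>i < n\<close> by (simp add: upd_conv_take_nth_drop)
  qed
qed

lemma hom_polysE:
  assumes "P \<in> hom_polys sE sF n"
  obtains A where "multilinear sE sF n A" "P = (\<lambda>x. A (replicate n x))" "continuous_on UNIV P"
  using assms unfolding hom_polys_def by blast

lemma poly_norm_le:
  assumes "\<And>x. norm x \<le> 1 \<Longrightarrow> norm (P x) \<le> C"
  shows "poly_norm (P :: 'e :: banach \<Rightarrow> 'f :: banach) \<le> C"
  unfolding poly_norm_def using assms by (intro cSUP_least) auto

context
  fixes sE :: "'k :: real_or_complex \<Rightarrow> 'e :: banach \<Rightarrow> 'e" and sF :: "'k \<Rightarrow> 'f :: banach \<Rightarrow> 'f"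
  assumes E: "banach_space_over sE" and F: "banach_space_over sF"
begin

interpretation E: banach_space_over sE by (fact E)
interpretation F: banach_space_over sF by (fact F)

lemma multilinear_add:
  "multilinear sE sF n A \<Longrightarrow> length as + length bs + 1 = n \<Longrightarrow>
    A (as @ (u + v) # bs) = A (as @ u # bs) + A (as @ v # bs)"
  and multilinear_scale:
  "multilinear sE sF n A \<Longrightarrow> length as + length bs + 1 = n \<Longrightarrow>
    A (as @ sE c u # bs) = sF c (A (as @ u # bs))"
  unfolding multilinear_iff linear_iff_over[OF E F] by blast+

lemma hom_poly_scale:
  assumes "P \<in> hom_polys sE sF n"
  shows "P (sE c x) = sF (c ^ n) (P x)"
proof -
  obtain A where A: "multilinear sE sF n A" "P = (\<lambda>x. A (replicate n x))"
    using assms by (rule hom_polysE)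
  have "A (replicate j (sE c x) @ replicate k x) = sF (c ^ j) (A (replicate n x))"
    if "j + k = n" for j k
    using that
  proof (induction j arbitrary: k)
    case (Suc j)
    have "A (replicate (Suc j) (sE c x) @ replicate k x)
        = A (replicate j (sE c x) @ sE c x # replicate k x)"
      by (simp add: replicate_append_same[symmetric])
    also have "\<dots> = sF c (A (replicate j (sE c x) @ replicate (Suc k) x))"
      using Suc.prems by (simp add: multilinear_scale[OF A(1)])
    also have "\<dots> = sF (c ^ Suc j) (A (replicate n x))"
      using Suc.IH[of "Suc k"] Suc.prems by simp
    finally show ?case .
  qed simp
  from this[of n 0] show ?thesis by (simp add: A)
qed

lemma hom_poly_add:
  assumes "P \<in> hom_polys sE sF n" "Q \<in> hom_polys sE sF n"
  shows "P + Q \<in> hom_polys sE sF n"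
proof -
  obtain A B where A: "multilinear sE sF n A" "P = (\<lambda>x. A (replicate n x))" "continuous_on UNIV P"
    and B: "multilinear sE sF n B" "Q = (\<lambda>x. B (replicate n x))" "continuous_on UNIV Q"
    using assms by (elim hom_polysE)
  have "multilinear sE sF n (\<lambda>xs. A xs + B xs)"
    using A(1) B(1) unfolding multilinear_iff linear_iff_over[OF E F]
    by (simp add: algebra_simps F.scale_right_distrib)
  moreover have "continuous_on UNIV (P + Q)"
    using A(3) B(3) unfolding plus_fun_def by (rule continuous_on_add)
  ultimately show ?thesis using A(2) B(2) by (auto simp: hom_polys_def)
qed

lemma hom_poly_fun_scale:
  assumes "P \<in> hom_polys sE sF n"
  shows "fun_scale sF c P \<in> hom_polys sE sF n"
proof -
  obtain A where A: "multilinear sE sF n A" "P = (\<lambda>x. A (replicate n x))" "continuous_on UNIV P"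
    using assms by (rule hom_polysE)
  have "multilinear sE sF n (\<lambda>xs. sF c (A xs))"
    using A(1) unfolding multilinear_iff linear_iff_over[OF E F]
    by (simp add: F.scale_right_distrib F.scale_left_commute)
  moreover have "continuous_on UNIV (fun_scale sF c P)"
    unfolding fun_scale_def
    using bounded_linear_scale[OF F] A(3) by (rule bounded_linear.continuous_on)
  ultimately show ?thesis using A(2) by (auto simp: hom_polys_def fun_scale_def)
qed

lemma hom_poly_zero: "0 \<in> hom_polys sE sF n"
proof -
  have "multilinear sE sF n (\<lambda>_. 0)"
    unfolding multilinear_iff linear_iff_over[OF E F] by simp
  then show ?thesis by (auto simp: hom_polys_def zero_fun_def)
qed

text \<open>
  Continuity at \<open>0\<close> bounds the polynomial on a small ball, and homogeneity transports the bound to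
  the unit ball.
\<close>

lemma bdd_above_hom_poly:
  assumes P: "P \<in> hom_polys sE sF n"
  shows "bdd_above ((\<lambda>x. norm (P x)) ` cball 0 1)"
proof -
  have "isCont P 0"
    using P by (auto simp: hom_polys_def continuous_on_eq_continuous_at)
  then obtain d where d: "d > 0" "\<And>x. norm x < d \<Longrightarrow> norm (P x - P 0) < 1"
    unfolding continuous_at_eps_delta by (metis dist_norm diff_zero zero_less_one)
  define c :: 'k where "c = of_real (d / 2)"
  have c: "c \<noteq> 0" "norm c = d / 2" using d by (auto simp: c_def norm_divide)
  show ?thesis
  proof (rule bdd_aboveI2)
    fix x :: 'e assume x: "x \<in> cball 0 1"
    have "norm (sE c x) \<le> d / 2"
      unfolding E.norm_scale c(2)[symmetric] using x by (intro mult_left_le) auto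
    then have "norm (P (sE c x) - P 0) < 1" using d by (intro d(2)) linarith
    then have "norm (P (sE c x)) \<le> 1 + norm (P 0)"
      using norm_triangle_sub[of "P (sE c x)" "P 0"] by linarith
    then have "norm c ^ n * norm (P x) \<le> 1 + norm (P 0)"
      by (simp add: hom_poly_scale[OF P] F.norm_scale norm_power)
    then show "norm (P x) \<le> (1 + norm (P 0)) / norm c ^ n"
      using c(1) by (simp add: field_simps)
  qed
qed

lemma norm_hom_poly_le:
  assumes P: "P \<in> hom_polys sE sF n"
  shows "norm (P x) \<le> poly_norm P * norm x ^ n"
proof -
  have ball: "norm (P y) \<le> poly_norm P" if "norm y \<le> 1" for y
    unfolding poly_norm_def using that by (intro cSUP_upper bdd_above_hom_poly[OF P]) simp
  show ?thesis
  proof (cases "x = 0")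
    case True
    have "P (sE 0 0) = sF (0 ^ n) (P 0)" by (rule hom_poly_scale[OF P])
    then show ?thesis using ball[of 0] True by (cases n) auto
  next
    case False
    define y where "y = sE (of_real (1 / norm x)) x"
    have y: "norm y \<le> 1" using False by (simp add: y_def E.norm_scale norm_divide)
    have "x = sE (of_real (norm x)) y"
      using False by (simp add: y_def flip: of_real_mult)
    then have "P x = sF (of_real (norm x) ^ n) (P y)" by (metis hom_poly_scale[OF P])
    then have "norm (P x) = norm x ^ n * norm (P y)" by (simp add: F.norm_scale norm_power)
    also have "\<dots> \<le> norm x ^ n * poly_norm P" using ball[OF y] by (intro mult_left_mono) auto
    finally show ?thesis by (simp add: mult.commute)
  qed
qed

lemma poly_norm_nonneg: "P \<in> hom_polys sE sF n \<Longrightarrow> poly_norm P \<ge> 0"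
  unfolding poly_norm_def
  by (rule cSUP_upper2[OF bdd_above_hom_poly, of _ n 0]) auto

lemma poly_norm_fun_scale:
  assumes P: "P \<in> hom_polys sE sF n"
  shows "poly_norm (fun_scale sF c P) = norm c * poly_norm P"
proof -
  have le: "poly_norm (fun_scale sF c P) \<le> norm c * poly_norm P" if P: "P \<in> hom_polys sE sF n" for c P
  proof (rule poly_norm_le)
    fix x :: 'e assume x: "norm x \<le> 1"
    have "norm (P x) \<le> poly_norm P * norm x ^ n" by (rule norm_hom_poly_le[OF P])
    also have "\<dots> \<le> poly_norm P * 1"
      using x poly_norm_nonneg[OF P] by (intro mult_left_mono power_le_one) auto
    finally show "norm (fun_scale sF c P x) \<le> norm c * poly_norm P"
      by (simp add: fun_scale_def F.norm_scale mult_left_mono)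
  qed
  have "norm c * poly_norm P \<le> poly_norm (fun_scale sF c P)"
  proof (cases "c = 0")
    case True
    then show ?thesis using poly_norm_nonneg[OF hom_poly_fun_scale[OF P]] by simp
  next
    case False
    then have "fun_scale sF (inverse c) (fun_scale sF c P) = P"
      by (simp add: fun_scale_def)
    then have "poly_norm P \<le> norm (inverse c) * poly_norm (fun_scale sF c P)"
      using le[OF hom_poly_fun_scale[OF P], of "inverse c" c] by simp
    then have "norm c * poly_norm P \<le> norm c * (norm (inverse c) * poly_norm (fun_scale sF c P))"
      by (intro mult_left_mono) auto
    also have "\<dots> = norm (c * inverse c) * poly_norm (fun_scale sF c P)"
      by (simp only: norm_mult mult.assoc)
    finally show ?thesis using False by simp
  qed
  with le[OF P, of c] show ?thesis by simp
qed

text \<open>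
  This family contains both kinds of polynomials that the proof tests with: the weakly
  continuous \<open>x \<mapsto> \<phi>(x)\<^sup>n y\<close>, and \<open>x \<mapsto> \<phi>(x)\<^sup>n\<^sup>-\<^sup>1 \<rho> x\<close>, which carries the information about \<open>F\<^sup>*\<^sup>*\<close>.
\<close>

lemma linear_times_power_hom_poly:
  assumes \<phi>: "\<phi> \<in> dual_space sE" and T: "Vector_Spaces.linear sE sF T" "continuous_on UNIV T"
  shows "(\<lambda>x. sF (\<phi> x ^ m) (T x)) \<in> hom_polys sE sF (Suc m)"
proof -
  have \<phi>_cont: "continuous_on UNIV \<phi>"
    by (rule bounded_linear.continuous_on[OF bounded_linear_dual_space[OF E \<phi>] continuous_on_id])
  define A where "A xs = sF (prod_list (map \<phi> (take m xs))) (T (xs ! m))" for xs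
  have T': "T (u + v) = T u + T v" "T (sE c u) = sF c (T u)" for u v c
    using T(1) by (auto simp: linear_iff_over[OF E F])
  have \<phi>': "\<phi> (u + v) = \<phi> u + \<phi> v" "\<phi> (sE c u) = c * \<phi> u" for u v c
    using \<phi> by (auto simp: dual_def)
  have "multilinear sE sF (Suc m) A"
    unfolding multilinear_iff linear_iff_over[OF E F]
  proof (intro allI impI)
    fix as bs :: "'e list" assume len: "length as + length bs + 1 = Suc m"
    show "(\<forall>u v. A (as @ (u + v) # bs) = A (as @ u # bs) + A (as @ v # bs)) \<and>
      (\<forall>c u. A (as @ sE c u # bs) = sF c (A (as @ u # bs)))"
    proof (cases bs rule: rev_cases)
      case Nil
      then show ?thesis using len by (simp add: A_def T' F.scale_right_distrib F.scale_left_commute nth_append)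
    next
      case (snoc cs y)
      have "A (as @ u # bs) = sF (prod_list (map \<phi> (as @ u # cs))) (T y)" for u
      proof -
        have "as @ u # bs = (as @ u # cs) @ [y]" using snoc by simp
        moreover have "length (as @ u # cs) = m" using len snoc by simp
        ultimately show ?thesis unfolding A_def by (metis append_eq_conv_conj nth_append_length)
      qed
      then show ?thesis by (simp add: \<phi>' algebra_simps F.scale_left_distrib)
    qed
  qed
  moreover have "sF (\<phi> x ^ m) (T x) = A (replicate (Suc m) x)" for x
  proof -
    have "replicate (Suc m) x = replicate m x @ [x]" by (simp add: replicate_append_same)
    then have "take m (replicate (Suc m) x) = replicate m x" "replicate (Suc m) x ! m = x"
      by (simp_all add: nth_append del: replicate.simps)
    then show ?thesis unfolding A_def by (simp del: replicate.simps take_replicate add: prod_list_replicate)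
  qed
  moreover have "continuous_on UNIV (\<lambda>x. sF (\<phi> x ^ m) (T x))"
    unfolding continuous_on_def
  proof (intro ballI tendsto_scale[OF F])
    fix x :: 'e
    show "((\<lambda>x. \<phi> x ^ m) \<longlongrightarrow> \<phi> x ^ m) (at x within UNIV)"
      using \<phi>_cont by (intro tendsto_power) (auto simp: continuous_on_def)
    show "(T \<longlongrightarrow> T x) (at x within UNIV)"
      using T(2) by (auto simp: continuous_on_def)
  qed
  ultimately show ?thesis by (auto simp: hom_polys_def)
qed

end

section \<open>Weakly continuous polynomials\<close>

text \<open>
  Frechet's notion of degree through iterated differences. It includes inhomogeneous polynomials and is
  stable under the passage to differences, so that one can do induction on the degree without
  polarization.
\<close>

primrec degree_le :: "nat \<Rightarrow> ('a :: ab_group_add \<Rightarrow> 'b :: ab_group_add) \<Rightarrow> bool"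
  where "degree_le 0 P \<longleftrightarrow> (\<forall>x y. P x = P y)"
  | "degree_le (Suc n) P \<longleftrightarrow> (\<forall>a. degree_le n (\<lambda>x. P (x + a) - P x))"

lemma degree_le_zero: "degree_le n (\<lambda>_. 0)"
  by (induction n) auto

lemma degree_le_add: "degree_le n P \<Longrightarrow> degree_le n Q \<Longrightarrow> degree_le n (\<lambda>x. P x + Q x)"
proof (induction n arbitrary: P Q)
  case 0
  then show ?case unfolding degree_le.simps by metis
next
  case (Suc n)
  show ?case
    unfolding degree_le.simps
  proof
    fix a
    have "degree_le n (\<lambda>x. (P (x + a) - P x) + (Q (x + a) - Q x))"
      using Suc.prems by (intro Suc.IH) auto
    then show "degree_le n (\<lambda>x. P (x + a) + Q (x + a) - (P x + Q x))"
      by (simp add: algebra_simps)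
  qed
qed

text \<open>
  The statement covers maps in which each slot of \<open>A\<close> is either a constant or a translate of the
  variable, \<open>m\<close> slots being of the second kind: this class is closed under differences, whereas
  \<open>x \<mapsto> A (x, \<dots>, x)\<close> alone is not. The difference with respect to \<open>a\<close> is telescoped, replacing \<open>x\<close> by
  \<open>x + a\<close> one slot after the other; each change contributes a term with the constant \<open>a\<close> in a slot
  that held a variable before, that is, with \<open>m - 1\<close> variable slots left.
\<close>

lemma degree_le_multiadditive:
  fixes A :: "'a :: ab_group_add list \<Rightarrow> 'b :: ab_group_add"
  assumes A: "\<And>as bs u v. length as + length bs + 1 = n \<Longrightarrow>
      A (as @ (u + v) # bs) = A (as @ u # bs) + A (as @ v # bs)"
  defines "arg \<equiv> \<lambda>x (b :: bool, c :: 'a). if b then x + c else c"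
  assumes "length cs = n" "length (filter fst cs) = m"
  shows "degree_le m (\<lambda>x. A (map (arg x) cs))"
  using assms(3,4)
proof (induction m arbitrary: cs)
  case 0
  then have "map (arg x) cs = map (arg y) cs" for x y
    by (auto simp: arg_def filter_empty_conv)
  then show ?case unfolding degree_le.simps by metis
next
  case (Suc m)
  note degree_le_m = Suc.IH and count_cs = Suc.prems(2)
  show ?case
    unfolding degree_le.simps
  proof
    fix a
    define shift where "shift = (\<lambda>(b :: bool, c :: 'a). (b, if b then c + a else c))"
    have arg_shift: "arg x (shift p) = arg (x + a) p" for x p
      by (auto simp: arg_def shift_def algebra_simps split: prod.splits)
    have fst_shift: "fst (shift p) = fst p" for p by (simp add: shift_def split: prod.splits)
    \<comment> \<open>The difference accumulated after shifting the first \<open>j\<close> slots.\<close>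
    define g where "g j x = A (map (arg x) (map shift (take j cs) @ drop j cs)) - A (map (arg x) cs)" for j x
    have "degree_le m (g j)" if "j \<le> n" for j
      using that
    proof (induction j)
      case 0
      then show ?case by (simp add: g_def[abs_def] degree_le_zero)
    next
      case (Suc j)
      then have IH: "degree_le m (g j)" and j: "j < length cs" using \<open>length cs = n\<close> by auto
      obtain b c where bc: "cs ! j = (b, c)" by fastforce
      define as bs where "as = map shift (take j cs)" and "bs = drop (Suc j) cs"
      have cs: "cs = take j cs @ (b, c) # bs" using id_take_nth_drop[OF j] bc by (simp add: bs_def)
      have drop: "drop j cs = (b, c) # bs" using Cons_nth_drop_Suc[OF j] bc by (simp add: bs_def)
      have take: "map shift (take (Suc j) cs) = as @ [shift (b, c)]"
        using take_Suc_conv_app_nth[OF j] bc by (simp add: as_def)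
      have len: "length as + length bs + 1 = n" using j \<open>length cs = n\<close> by (simp add: as_def bs_def)
      have gj: "g j x = A (map (arg x) as @ arg x (b, c) # map (arg x) bs) - A (map (arg x) cs)" for x
        by (simp add: g_def drop as_def)
      have gSj: "g (Suc j) x = A (map (arg x) as @ arg x (shift (b, c)) # map (arg x) bs) - A (map (arg x) cs)" for x
        unfolding g_def take by (simp add: bs_def)
      show ?case
      proof (cases b)
        case False
        then have "g (Suc j) = g j" by (auto simp: gj gSj shift_def)
        then show ?thesis using IH by simp
      next
        case True
        have "g (Suc j) x = g j x + A (map (arg x) (as @ (False, a) # bs))" for x
        proof -
          have "arg x (shift (b, c)) = arg x (b, c) + a" using True
            by (simp add: arg_def shift_def add.assoc)
          then show ?thesis
            unfolding gSj gj using A[of "map (arg x) as" "map (arg x) bs"] len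
            by (simp add: arg_def)
        qed
        moreover have "degree_le m (\<lambda>x. A (map (arg x) (as @ (False, a) # bs)))"
        proof (rule degree_le_m)
          have "length (filter fst as) = length (filter fst (take j cs))"
            by (simp add: as_def filter_map o_def fst_shift)
          moreover have "length (filter fst (take j cs @ (b, c) # bs)) = Suc m"
            using count_cs cs by simp
          ultimately show "length (filter fst (as @ (False, a) # bs)) = m" using True by simp
        qed (use len in simp)
        ultimately show ?thesis using degree_le_add[OF IH] by presburger
      qed
    qed
    from this[of n] show "degree_le m (\<lambda>x. A (map (arg (x + a)) cs) - A (map (arg x) cs))"
      using \<open>length cs = n\<close> by (simp add: g_def[abs_def] o_def arg_shift)
  qed
qed

lemma weakly_continuous_diff_translate:
  assumes P: "weakly_continuous_on_bounded sE P"
  shows "weakly_continuous_on_bounded sE (\<lambda>x. P (x + a) - P x)"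
  unfolding weakly_continuous_on_bounded_def
proof (intro allI impI tendsto_diff)
  fix G b
  assume bdd: "\<exists>B. bounded B \<and> (\<forall>\<^sub>F x in G. x \<in> B)" and w: "weakly_converges sE (\<lambda>x. x) b G"
  then show "(P \<longlongrightarrow> P b) G" using P unfolding weakly_continuous_on_bounded_def by blast
  obtain B where B: "bounded B" "\<forall>\<^sub>F x in G. x \<in> B" using bdd by blast
  show "((\<lambda>x. P (x + a)) \<longlongrightarrow> P (b + a)) G"
  proof (rule weakly_continuous_on_bounded_net[OF P])
    show "bounded ((\<lambda>x. a + x) ` B)" using B(1) by (rule bounded_translation)
    show "\<forall>\<^sub>F x in G. x + a \<in> (\<lambda>x. a + x) ` B"
      using B(2) by eventually_elim (simp add: add.commute)
    show "weakly_converges sE (\<lambda>x. x + a) (b + a) G"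
      using w by (auto simp: weakly_converges_def dual_space_add intro: tendsto_add)
  qed
qed

context
  fixes sE :: "'k :: real_or_complex \<Rightarrow> 'e :: banach \<Rightarrow> 'e"
  assumes E: "banach_space_over sE"
begin

text \<open>
  Polynomials that are weakly continuous on bounded sets are even weakly uniformly continuous there, a
  result of Aron, Herves and Valdivia; the form needed here is that they converge along bounded
  weakly Cauchy filters, whose weak* limit may lie outside \<open>E\<close>. The induction on the degree writes \<open>P x\<close> as
  the sum of \<open>P (x - x\<^sub>0)\<close> and \<open>P ((x - x\<^sub>0) + x\<^sub>0) - P (x - x\<^sub>0)\<close>.
  When \<open>x\<close> and \<open>x\<^sub>0\<close> both run along the filter, \<open>x - x\<^sub>0\<close> tends weakly to \<open>0\<close>, so the first summand is
  close to \<open>P 0\<close> for a suitable fixed \<open>x\<^sub>0\<close> and eventually all \<open>x\<close>. The second summand is a polynomial of smaller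
  degree in \<open>x - x\<^sub>0\<close>, and converges by induction.
\<close>

lemma tendsto_weakly_Cauchy:
  fixes P :: "'e \<Rightarrow> 'f :: banach"
  assumes "degree_le n P" "weakly_continuous_on_bounded sE P" "U \<noteq> bot"
    and "\<forall>\<^sub>F x in U. norm x \<le> r" "\<And>\<phi>. \<phi> \<in> dual_space sE \<Longrightarrow> \<exists>l. (\<phi> \<longlongrightarrow> l) U"
  shows "\<exists>y. (P \<longlongrightarrow> y) U"
  using assms
proof (induction n arbitrary: P U r)
  case 0
  then have "P = (\<lambda>_. P 0)" by auto
  then show ?case by (metis tendsto_const)
next
  case (Suc n)
  note U = Suc.prems(3,4,5)
  have lim: "((\<lambda>(x, x0). P (x - x0)) \<longlongrightarrow> P 0) (U \<times>\<^sub>F U)"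
    unfolding case_prod_beta
  proof (rule weakly_continuous_on_bounded_net[OF Suc.prems(2)])
    show "bounded (cball (0 :: 'e) (2 * r))" by simp
    have "\<forall>\<^sub>F p in U \<times>\<^sub>F U. norm (fst p) \<le> r" "\<forall>\<^sub>F p in U \<times>\<^sub>F U. norm (snd p) \<le> r"
      by (rule eventually_compose_filterlim[OF U(2) filterlim_fst]
          eventually_compose_filterlim[OF U(2) filterlim_snd])+
    then show "\<forall>\<^sub>F p in U \<times>\<^sub>F U. fst p - snd p \<in> cball 0 (2 * r)"
    proof eventually_elim
      case (elim p)
      then show ?case using norm_triangle_ineq4[of "fst p" "snd p"] by simp
    qed
    show "weakly_converges sE (\<lambda>p. fst p - snd p) 0 (U \<times>\<^sub>F U)"
      unfolding weakly_converges_def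
    proof
      fix \<phi> assume \<phi>: "\<phi> \<in> dual_space sE"
      then obtain l where l: "(\<phi> \<longlongrightarrow> l) U" using U(3) by blast
      have "((\<lambda>p. \<phi> (fst p) - \<phi> (snd p)) \<longlongrightarrow> l - l) (U \<times>\<^sub>F U)"
        by (intro tendsto_diff filterlim_compose[OF l] filterlim_fst filterlim_snd)
      then show "((\<lambda>p. \<phi> (fst p - snd p)) \<longlongrightarrow> \<phi> 0) (U \<times>\<^sub>F U)"
        using dual_space_diff[OF E \<phi>, of 0 0] by (simp add: dual_space_diff[OF E \<phi>])
    qed
  qed
  have "cauchy_filter (filtermap P U)"
    unfolding cauchy_filter_metric
  proof (intro allI impI)
    fix e :: real assume "e > 0"
    then have e: "e / 4 > 0" by simp
    have "\<forall>\<^sub>F p in U \<times>\<^sub>F U. dist (case p of (x, x0) \<Rightarrow> P (x - x0)) (P 0) < e / 4"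
      by (rule tendstoD[OF lim e])
    then obtain Q R where QR: "eventually Q U" "eventually R U"
      "\<And>x x0. Q x \<Longrightarrow> R x0 \<Longrightarrow> dist (P (x - x0)) (P 0) < e / 4"
      unfolding eventually_prod_filter by auto
    obtain x0 where x0: "R x0" "norm x0 \<le> r"
      using eventually_happens'[OF U(1) eventually_conj[OF QR(2) U(2)]] by blast
    have "\<exists>y. ((\<lambda>z. P (z + x0) - P z) \<longlongrightarrow> y) (filtermap (\<lambda>x. x - x0) U)"
    proof (rule Suc.IH)
      show "degree_le n (\<lambda>z. P (z + x0) - P z)" using Suc.prems(1) by simp
      show "weakly_continuous_on_bounded sE (\<lambda>z. P (z + x0) - P z)"
        by (rule weakly_continuous_diff_translate[OF Suc.prems(2)])
      show "filtermap (\<lambda>x. x - x0) U \<noteq> bot" using U(1) by (simp add: filtermap_bot_iff)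
      have "\<forall>\<^sub>F x in U. norm (x - x0) \<le> 2 * r"
        using U(2)
      proof eventually_elim
        case (elim x)
        then show ?case using norm_triangle_ineq4[of x x0] x0(2) by simp
      qed
      then show "\<forall>\<^sub>F x in filtermap (\<lambda>x. x - x0) U. norm x \<le> 2 * r"
        by (simp add: eventually_filtermap)
      show "\<exists>l. (\<phi> \<longlongrightarrow> l) (filtermap (\<lambda>x. x - x0) U)" if \<phi>: "\<phi> \<in> dual_space sE" for \<phi>
      proof -
        obtain l where "(\<phi> \<longlongrightarrow> l) U" using U(3) \<phi> by blast
        then have "((\<lambda>x. \<phi> (x - x0)) \<longlongrightarrow> l - \<phi> x0) U"
          by (simp add: dual_space_diff[OF E \<phi>] tendsto_diff)
        then show ?thesis by (auto simp: filterlim_filtermap)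
      qed
    qed
    then obtain y where "((\<lambda>x. P x - P (x - x0)) \<longlongrightarrow> y) U"
      by (auto simp: filterlim_filtermap)
    from tendstoD[OF this e] have "\<forall>\<^sub>F x in U. dist (P x - P (x - x0)) y < e / 4" .
    with QR(1) have ev: "\<forall>\<^sub>F x in U. dist (P x) (y + P 0) < e / 2"
    proof eventually_elim
      case (elim x)
      have "P x - (y + P 0) = (P x - P (x - x0) - y) + (P (x - x0) - P 0)" by simp
      then have "dist (P x) (y + P 0) \<le> dist (P x - P (x - x0)) y + dist (P (x - x0)) (P 0)"
        unfolding dist_norm by (metis norm_triangle_ineq)
      then show ?case using QR(3)[OF elim(1) x0(1)] elim(2) by simp
    qed
    then show "\<exists>S. eventually S (filtermap P U) \<and> (\<forall>u v. S u \<and> S v \<longrightarrow> dist u v < e)"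
      by (intro exI[of _ "\<lambda>u. dist u (y + P 0) < e / 2"])
        (auto simp: eventually_filtermap intro: dist_triangle_half_l)
  qed
  then have "\<exists>y. filtermap P U \<le> nhds y"
    using U(1) by (intro cauchy_filter_complete_converges complete_UNIV)
      (auto simp: filtermap_bot_iff)
  then show ?case by (auto simp: filterlim_def)
qed

end

section \<open>The canonical embedding\<close>

lemma canonical_embedding_apply: "\<phi> \<in> dual_space s \<Longrightarrow> canonical_embedding s y \<phi> = \<phi> y"
  by (simp add: canonical_embedding_def)

lemma canonical_embedding_add:
  "canonical_embedding s (x + y) = canonical_embedding s x + canonical_embedding s y"
  by (auto simp: canonical_embedding_def dual_space_add)

lemma canonical_embedding_scale:
  "canonical_embedding s (s c x) = fun_scale (*) c (canonical_embedding s x)"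
  by (auto simp: canonical_embedding_def dual_space_scale fun_scale_def)

lemma module_fun_scale_mult: "module (fun_scale ((*) :: 'k :: real_or_complex \<Rightarrow> 'k \<Rightarrow> 'k) :: 'k \<Rightarrow> ('a \<Rightarrow> 'k) \<Rightarrow> _)"
  by unfold_locales (auto simp: fun_scale_def algebra_simps)

context
  fixes sE :: "'k :: real_or_complex \<Rightarrow> 'e :: banach \<Rightarrow> 'e"
  assumes E: "banach_space_over sE"
begin

lemma canonical_embedding_bidual:
  "canonical_embedding sE y \<in> bidual sE" "bidual_norm sE (canonical_embedding sE y) \<le> norm y"
proof -
  have 1: "canonical_embedding sE y \<phi> = 0" if "\<phi> \<notin> dual_space sE" for \<phi>
    using that by (simp add: canonical_embedding_def)
  have 2: "canonical_embedding sE y (\<phi> + \<psi>) = canonical_embedding sE y \<phi> + canonical_embedding sE y \<psi>"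
    if "\<phi> \<in> dual_space sE" "\<psi> \<in> dual_space sE" for \<phi> \<psi>
    using that by (simp add: canonical_embedding_apply dual_closed_add)
  have 3: "canonical_embedding sE y (fun_scale (*) c \<phi>) = c * canonical_embedding sE y \<phi>"
    if "\<phi> \<in> dual_space sE" for c \<phi>
    by (simp only: canonical_embedding_apply fun_scale_dual_space[OF E that] that) (simp add: fun_scale_def)
  have 4: "norm (canonical_embedding sE y \<phi>) \<le> norm y * dual_space_norm \<phi>"
    if "\<phi> \<in> dual_space sE" for \<phi>
    using dual_space_bound[OF E that] by (simp add: canonical_embedding_apply that mult.commute)
  show "canonical_embedding sE y \<in> bidual sE" "bidual_norm sE (canonical_embedding sE y) \<le> norm y"
    by (rule bidualI[OF E 1 2 3 4 norm_ge_zero]; assumption)+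
qed

text \<open>
  Norming functionals show that a sequence in the space whose images converge in the bidual is
  Cauchy; the space being complete, its limit is mapped to the limit of the images.
\<close>

lemma closed_subspace_canonical_embedding:
  "closed_subspace (fun_scale (*)) (bidual_norm sE) (range (canonical_embedding sE)) (bidual sE)"
  unfolding closed_subspace_def
proof (intro conjI ballI impI)
  show "range (canonical_embedding sE) \<subseteq> bidual sE" using canonical_embedding_bidual by blast
  have "canonical_embedding sE 0 = 0"
    using canonical_embedding_add[of sE 0 0] by simp
  then show "module.subspace (fun_scale (*)) (range (canonical_embedding sE))"
    unfolding module.subspace_def[OF module_fun_scale_mult]
    by (metis (mono_tags, lifting) canonical_embedding_add canonical_embedding_scale rangeE rangeI)
  fix z assume z: "z \<in> bidual sE"
    and "\<forall>e>0. \<exists>w\<in>range (canonical_embedding sE). bidual_norm sE (z - w) < e"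
  then have "\<forall>k. \<exists>y. bidual_norm sE (z - canonical_embedding sE y) < inverse (real (Suc k))"
    by auto
  from choice[OF this] obtain y
    where y: "\<And>k. bidual_norm sE (z - canonical_embedding sE (y k)) < inverse (real (Suc k))" by blast
  have bound: "norm (z \<phi> - \<phi> (y k)) \<le> inverse (real (Suc k)) * dual_space_norm \<phi>"
    if \<phi>: "\<phi> \<in> dual_space sE" for \<phi> k
  proof -
    have "z - canonical_embedding sE (y k) = z + canonical_embedding sE (sE (- 1) (y k))"
      by (simp add: canonical_embedding_scale fun_scale_def fun_eq_iff)
    then have "z - canonical_embedding sE (y k) \<in> bidual sE"
      using dual_closed_add[OF z[unfolded bidual_def] canonical_embedding_bidual(1)[unfolded bidual_def]]
      by (simp only: bidual_def)
    then have "norm ((z - canonical_embedding sE (y k)) \<phi>)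
        \<le> bidual_norm sE (z - canonical_embedding sE (y k)) * dual_space_norm \<phi>"
      unfolding bidual_def bidual_norm_def
      by (rule norm_le_dual_norm[OF homogeneous_norm_dual_space[OF E] _ \<phi>])
    also have "\<dots> \<le> inverse (real (Suc k)) * dual_space_norm \<phi>"
      using less_imp_le[OF y] dual_norm_nonneg[OF homogeneous_norm_UNIV[OF E] \<phi>]
      by (rule mult_right_mono)
    finally show ?thesis using \<phi> by (simp add: canonical_embedding_apply)
  qed
  have "Cauchy y"
  proof (rule metric_CauchyI)
    fix e :: real assume "e > 0"
    then obtain K where K: "inverse (real (Suc K)) < e / 2"
      using reals_Archimedean[of "e / 2"] by auto
    have "dist (y k) (y l) < e" if kl: "k \<ge> K" "l \<ge> K" for k l
    proof -
      obtain \<phi> where \<phi>: "\<forall>u v. \<phi> (u + v) = \<phi> u + \<phi> v" "\<forall>c u. \<phi> (sE c u) = c * \<phi> u"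
        "\<forall>u. norm (\<phi> u) \<le> norm u" "norm (y k - y l) \<le> norm (\<phi> (y k - y l))"
        using norming_functional[OF E] by blast
      have \<phi>': "\<phi> \<in> dual_space sE" by (rule dualI[where C = 1]) (use \<phi> in auto)
      have "dual_space_norm \<phi> \<le> 1"
        by (rule dual_norm_le[OF homogeneous_norm_UNIV[OF E]]) (use \<phi> in auto)
      then have le: "norm (z \<phi> - \<phi> (y j)) < e / 2" if "j \<ge> K" for j
      proof -
        have "norm (z \<phi> - \<phi> (y j)) \<le> inverse (real (Suc j)) * dual_space_norm \<phi>" by (rule bound[OF \<phi>'])
        also have "\<dots> \<le> inverse (real (Suc j)) * 1"
          using \<open>dual_space_norm \<phi> \<le> 1\<close> by (intro mult_left_mono) auto
        also have "\<dots> \<le> inverse (real (Suc K))" using that by (simp add: le_imp_inverse_le)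
        finally show ?thesis using K by simp
      qed
      have "\<phi> (y k - y l) = (z \<phi> - \<phi> (y l)) - (z \<phi> - \<phi> (y k))" by (simp add: dual_space_diff[OF E \<phi>'])
      then have "norm (\<phi> (y k - y l)) \<le> norm (z \<phi> - \<phi> (y l)) + norm (z \<phi> - \<phi> (y k))"
        by (metis norm_triangle_ineq4)
      with le[OF kl(1)] le[OF kl(2)] \<phi>(4) show ?thesis by (simp add: dist_norm)
    qed
    then show "\<exists>K. \<forall>k\<ge>K. \<forall>l\<ge>K. dist (y k) (y l) < e" by blast
  qed
  then obtain x where x: "y \<longlonglongrightarrow> x" using convergent_eq_Cauchy by blast
  have "z \<phi> = canonical_embedding sE x \<phi>" for \<phi>
  proof (cases "\<phi> \<in> dual_space sE")
    case True
    have "(\<lambda>k. z \<phi> - \<phi> (y k)) \<longlonglongrightarrow> 0"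
    proof (rule Lim_null_comparison)
      show "\<forall>\<^sub>F k in sequentially. norm (z \<phi> - \<phi> (y k)) \<le> inverse (real (Suc k)) * dual_space_norm \<phi>"
        using bound[OF True] by simp
      show "(\<lambda>k. inverse (real (Suc k)) * dual_space_norm \<phi>) \<longlonglongrightarrow> 0"
        by (intro tendsto_mult_left_zero LIMSEQ_inverse_real_of_nat)
    qed
    moreover have "(\<lambda>k. z \<phi> - \<phi> (y k)) \<longlonglongrightarrow> z \<phi> - \<phi> x"
      by (intro tendsto_diff tendsto_const bounded_linear.tendsto[OF bounded_linear_dual_space[OF E True] x])
    ultimately have "z \<phi> - \<phi> x = 0" by (rule LIMSEQ_unique[symmetric])
    then show ?thesis using True by (simp add: canonical_embedding_apply)
  next
    case False
    then show ?thesis using z by (simp add: canonical_embedding_def bidual_def dual_outside)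
  qed
  then show "z \<in> range (canonical_embedding sE)" by blast
qed

end

section \<open>Limits along ultrafilters in the bidual\<close>

text \<open>
  The weak* limit in the bidual of a bounded family in the space.
\<close>

definition bidual_limit ::
    "('k :: real_or_complex \<Rightarrow> 'e :: banach \<Rightarrow> 'e) \<Rightarrow> 'i filter \<Rightarrow> ('i \<Rightarrow> 'e) \<Rightarrow> ('e \<Rightarrow> 'k) \<Rightarrow> 'k"
  where "bidual_limit s U f = (\<lambda>\<psi>. if \<psi> \<in> dual_space s then Lim U (\<lambda>i. \<psi> (f i)) else 0)"

lemma bidual_limit_eqI:
  assumes "U \<noteq> bot" "\<And>\<psi>. \<psi> \<in> dual_space s \<Longrightarrow> ((\<lambda>i. \<psi> (f i)) \<longlongrightarrow> z \<psi>) U"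
    and "\<And>\<psi>. \<psi> \<notin> dual_space s \<Longrightarrow> z \<psi> = 0"
  shows "bidual_limit s U f = z"
  using assms by (auto simp: bidual_limit_def fun_eq_iff intro!: tendsto_Lim)

context
  fixes sE :: "'k :: real_or_complex \<Rightarrow> 'e :: banach \<Rightarrow> 'e"
  assumes E: "banach_space_over sE"
begin

context
  fixes U :: "'i filter" and f :: "'i \<Rightarrow> 'e" and C :: real
  assumes U: "ultrafilter U" and f: "\<forall>\<^sub>F i in U. norm (f i) \<le> C"
begin

lemma bidual_limit_tendsto:
  assumes \<psi>: "\<psi> \<in> dual_space sE"
  shows "((\<lambda>i. \<psi> (f i)) \<longlongrightarrow> bidual_limit sE U f \<psi>) U"
proof -
  have nonneg: "dual_space_norm \<psi> \<ge> 0" by (rule dual_norm_nonneg[OF homogeneous_norm_UNIV[OF E] \<psi>])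
  have "\<forall>\<^sub>F i in U. norm (\<psi> (f i)) \<le> dual_space_norm \<psi> * C"
    using f
  proof eventually_elim
    case (elim i)
    then show ?case using dual_space_bound[OF E \<psi>, of "f i"] mult_left_mono[OF elim nonneg] by linarith
  qed
  then obtain l where l: "((\<lambda>i. \<psi> (f i)) \<longlongrightarrow> l) U"
    using ultrafilter_tendsto_scalar[OF U, of "\<lambda>i. \<psi> (f i)"] by metis
  then have "Lim U (\<lambda>i. \<psi> (f i)) = l" using U by (intro tendsto_Lim) (auto simp: ultrafilter_def)
  with l \<psi> show ?thesis by (simp add: bidual_limit_def)
qed

lemma bidual_limit_bidual:
  shows "bidual_limit sE U f \<in> bidual sE" "bidual_norm sE (bidual_limit sE U f) \<le> C"
proof -
  have ne: "U \<noteq> bot" using U by (simp add: ultrafilter_def)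
  note lim = bidual_limit_tendsto
  note unique = tendsto_unique[OF ne]
  have C: "C \<ge> 0" using eventually_happens'[OF ne f] norm_ge_zero order_trans by blast
  have add: "bidual_limit sE U f (\<phi> + \<psi>) = bidual_limit sE U f \<phi> + bidual_limit sE U f \<psi>"
    if "\<phi> \<in> dual_space sE" "\<psi> \<in> dual_space sE" for \<phi> \<psi>
  proof (rule unique[OF lim[OF dual_closed_add[OF that]]])
    show "((\<lambda>i. (\<phi> + \<psi>) (f i)) \<longlongrightarrow> bidual_limit sE U f \<phi> + bidual_limit sE U f \<psi>) U"
      using that by (simp add: tendsto_add lim)
  qed
  have scale: "bidual_limit sE U f (fun_scale (*) c \<phi>) = c * bidual_limit sE U f \<phi>"
    if "\<phi> \<in> dual_space sE" for \<phi> c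
  proof (rule unique[OF lim[OF fun_scale_dual_space[OF E that]]])
    show "((\<lambda>i. fun_scale (*) c \<phi> (f i)) \<longlongrightarrow> c * bidual_limit sE U f \<phi>) U"
      unfolding fun_scale_def by (intro tendsto_mult_left lim[OF that])
  qed
  have bound: "norm (bidual_limit sE U f \<phi>) \<le> C * dual_space_norm \<phi>" if \<phi>: "\<phi> \<in> dual_space sE" for \<phi>
  proof (rule tendsto_upperbound[OF tendsto_norm[OF lim[OF \<phi>]] _ ne])
    have nonneg: "dual_space_norm \<phi> \<ge> 0" by (rule dual_norm_nonneg[OF homogeneous_norm_UNIV[OF E] \<phi>])
    show "\<forall>\<^sub>F i in U. norm (\<phi> (f i)) \<le> C * dual_space_norm \<phi>"
      using f
    proof eventually_elim
      case (elim i)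
      then show ?case using dual_space_bound[OF E \<phi>, of "f i"] mult_left_mono[OF elim nonneg]
        by (simp add: mult.commute)
    qed
  qed
  show "bidual_limit sE U f \<in> bidual sE" "bidual_norm sE (bidual_limit sE U f) \<le> C"
    by (rule bidualI[OF E _ add scale bound C]; simp add: bidual_limit_def)+
qed

end

end

section \<open>Uniqueness of norm-preserving extensions to the bidual\<close>

text \<open>
  Surjectivity of the second adjoint of a surjective operator. By Goldstine's theorem, \<open>z\<close> is a
  weak* limit of a bounded filter on \<open>F\<close>, which a bounded right inverse of \<open>\<rho>\<close> transports to \<open>E\<close>;
  any weak* limit of the image does the job. Its norm is not controlled, which is why Goldstine's
  theorem is applied once more in \<open>E\<close> afterwards.
\<close>

lemma lift_to_bidual:
  fixes sE :: "'k :: real_or_complex \<Rightarrow> 'e :: banach \<Rightarrow> 'e" and sF :: "'k \<Rightarrow> 'f :: banach \<Rightarrow> 'f"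
  assumes E: "banach_space_over sE" and F: "banach_space_over sF"
    and \<rho>: "bounded_linear \<rho>" "surj \<rho>" and dual: "\<And>\<psi>. \<psi> \<in> dual_space sF \<Longrightarrow> (\<lambda>x. \<psi> (\<rho> x)) \<in> dual_space sE"
    and z: "z \<in> bidual sF"
  shows "\<exists>\<Xi>\<in>bidual sE. \<forall>\<psi>\<in>dual_space sF. \<Xi> (\<lambda>x. \<psi> (\<rho> x)) = z \<psi>"
proof -
  obtain S C where S: "C \<ge> 0" "\<And>y. \<rho> (S y) = y" "\<And>y. norm (S y) \<le> C * norm y"
    using bounded_right_inverse[OF \<rho>] by blast
  obtain U where U: "ultrafilter U" "\<forall>\<^sub>F y in U. norm y \<le> bidual_norm sF z"
    "\<forall>\<psi>\<in>dual_space sF. (\<psi> \<longlongrightarrow> z \<psi>) U"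
    using Goldstine[OF F z] by blast
  have bound: "\<forall>\<^sub>F y in U. norm (S y) \<le> C * bidual_norm sF z"
    using U(2)
  proof eventually_elim
    case (elim y)
    then show ?case using S(3)[of y] mult_left_mono[OF elim S(1)] by linarith
  qed
  have "bidual_limit sE U S (\<lambda>x. \<psi> (\<rho> x)) = z \<psi>" if "\<psi> \<in> dual_space sF" for \<psi>
  proof (rule tendsto_unique)
    show "U \<noteq> bot" using U(1) by (simp add: ultrafilter_def)
    show "((\<lambda>y. \<psi> (\<rho> (S y))) \<longlongrightarrow> bidual_limit sE U S (\<lambda>x. \<psi> (\<rho> x))) U"
      by (rule bidual_limit_tendsto[OF E U(1) bound dual[OF that]])
    show "((\<lambda>y. \<psi> (\<rho> (S y))) \<longlongrightarrow> z \<psi>) U" using U(3) that by (simp add: S(2))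
  qed
  moreover have "bidual_limit sE U S \<in> bidual sE" by (rule bidual_limit_bidual[OF E U(1) bound])
  ultimately show ?thesis by blast
qed

context
  fixes sE :: "'k :: real_or_complex \<Rightarrow> 'e :: banach \<Rightarrow> 'e" and sF :: "'k \<Rightarrow> 'f :: banach \<Rightarrow> 'f"
  assumes E: "banach_space_over sE" and F: "banach_space_over sF"
begin

lemma degree_le_hom_poly:
  assumes "P \<in> hom_polys sE sF n"
  shows "degree_le n P"
proof -
  obtain A where A: "multilinear sE sF n A" "P = (\<lambda>x. A (replicate n x))"
    using hom_polysE[OF assms] by blast
  have "degree_le n (\<lambda>x. A (map ((\<lambda>x (b :: bool, c). if b then x + c else c) x) (replicate n (True, 0))))"
    by (rule degree_le_multiadditive[where n = n]) (simp_all add: multilinear_add[OF E F A(1)])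
  then show ?thesis by (simp add: A(2))
qed

lemma homogeneous_norm_hom_polys: "homogeneous_norm (fun_scale sF) poly_norm (hom_polys sE sF n)"
  using hom_poly_zero[OF E F] poly_norm_nonneg[OF E F] hom_poly_fun_scale[OF E F]
    poly_norm_fun_scale[OF E F]
  by (simp add: homogeneous_norm_def)

lemma module_fun_scale: "module (fun_scale sF :: 'k \<Rightarrow> ('a \<Rightarrow> 'f) \<Rightarrow> _)"
proof -
  interpret banach_space_over sF by (fact F)
  show ?thesis
    by unfold_locales (auto simp: fun_scale_def scale_right_distrib scale_left_distrib)
qed

lemma power_times_vector_weak_hom_poly:
  assumes \<phi>: "\<phi> \<in> dual_space sE"
  shows "(\<lambda>x. sF (\<phi> x ^ Suc m) y) \<in> weak_hom_polys sE sF (Suc m)"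
proof -
  interpret F: banach_space_over sF by (fact F)
  have cont: "continuous_on UNIV \<phi>"
    by (rule bounded_linear.continuous_on[OF bounded_linear_dual_space[OF E \<phi>] continuous_on_id])
  have "(\<lambda>x. sF (\<phi> x ^ m) (sF (\<phi> x) y)) \<in> hom_polys sE sF (Suc m)"
  proof (rule linear_times_power_hom_poly[OF E F \<phi>])
    show "Vector_Spaces.linear sE sF (\<lambda>x. sF (\<phi> x) y)"
      unfolding linear_iff_over[OF E F]
      by (simp add: dual_space_add[OF \<phi>] dual_space_scale[OF \<phi>] F.scale_left_distrib)
    show "continuous_on UNIV (\<lambda>x. sF (\<phi> x) y)"
      by (rule bounded_linear.continuous_on[OF bounded_linear_scale_left[OF F] cont])
  qed
  then have "(\<lambda>x. sF (\<phi> x ^ Suc m) y) \<in> hom_polys sE sF (Suc m)"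
    unfolding F.scale_scale power_Suc2 .
  moreover have "weakly_continuous_on_bounded sE (\<lambda>x. sF (\<phi> x ^ Suc m) y)"
    unfolding weakly_continuous_on_bounded_def
  proof (intro allI impI)
    fix G a assume "weakly_converges sE (\<lambda>x. x) a G"
    then have "(\<phi> \<longlongrightarrow> \<phi> a) G" using \<phi> by (simp add: weakly_converges_def)
    then show "((\<lambda>x. sF (\<phi> x ^ Suc m) y) \<longlongrightarrow> sF (\<phi> a ^ Suc m) y) G"
      by (intro tendsto_scale[OF F] tendsto_power tendsto_const)
  qed
  ultimately show ?thesis by (simp add: weak_hom_polys_def)
qed

context
  fixes n :: nat
  assumes n: "n \<ge> 1"
    and smooth: "HB_smooth (fun_scale sF) poly_norm (weak_hom_polys sE sF n) (hom_polys sE sF n)"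
begin

lemma subspace_weak_hom_polys: "module.subspace (fun_scale sF) (weak_hom_polys sE sF n)"
  using smooth unfolding HB_smooth_def closed_subspace_def by blast

lemma homogeneous_norm_weak_hom_polys:
  "homogeneous_norm (fun_scale sF) poly_norm (weak_hom_polys sE sF n)"
  using subspace_weak_hom_polys unfolding module.subspace_def[OF module_fun_scale]
  by (intro homogeneous_norm_subset[OF homogeneous_norm_hom_polys]) (auto simp: weak_hom_polys_def)

text \<open>
  The heart of the proof: \<open>\<Phi>1\<close> and \<open>\<Phi>2\<close> below are norm-preserving extensions of the same functional
  \<open>g\<close> on the weakly continuous polynomials.
\<close>

lemma extension_to_bidual_unique:
  assumes \<rho>: "Vector_Spaces.linear sE sF \<rho>" "bounded_linear \<rho>" "surj \<rho>"
    and f: "f \<in> dual_space sF"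
    and f': "f' \<in> dual (fun_scale (*)) (bidual_norm sF) (bidual sF)"
      "\<And>y. f' (canonical_embedding sF y) = f y"
      "dual_norm (bidual_norm sF) (bidual sF) f' \<le> dual_space_norm f"
    and z: "z \<in> bidual sF"
  shows "f' z = z f"
proof -
  interpret F: banach_space_over sF by (fact F)
  note HF = homogeneous_norm_UNIV[OF F] and HF' = homogeneous_norm_dual_space[OF F]
    and HF'' = homogeneous_norm_bidual[OF F] and HE' = homogeneous_norm_dual_space[OF E]
    and HX = homogeneous_norm_hom_polys[of n] and HJ = homogeneous_norm_weak_hom_polys
  let ?X = "hom_polys sE sF n" and ?J = "weak_hom_polys sE sF n"
  obtain m where m: "n = Suc m" using n by (cases n) auto
  have JX: "?J \<subseteq> ?X" by (auto simp: weak_hom_polys_def)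
  have f'_scale: "f' (fun_scale (*) c w) = c * f' w" if "w \<in> bidual sF" for c w
    using dual_scale[OF f'(1) that] .
  have dual_comp: "(\<lambda>x. \<psi> (\<rho> x)) \<in> dual_space sE" if \<psi>: "\<psi> \<in> dual_space sF" for \<psi>
  proof -
    have "bounded_linear (\<lambda>x. \<psi> (\<rho> x))"
      using bounded_linear_compose[OF bounded_linear_dual_space[OF F \<psi>] \<rho>(2)] .
    then obtain K where K: "\<And>x. norm (\<psi> (\<rho> x)) \<le> norm x * K"
      using bounded_linear.bounded by blast
    have \<rho>': "\<rho> (u + v) = \<rho> u + \<rho> v" "\<rho> (sE c u) = sF c (\<rho> u)" for u v c
      using \<rho>(1) by (auto simp: linear_iff_over[OF E F])
    show ?thesis
      by (rule dualI[where C = K])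
        (use K in \<open>auto simp: \<rho>' dual_space_add[OF \<psi>] dual_space_scale[OF \<psi>] mult.commute\<close>)
  qed
  obtain \<Xi> where \<Xi>: "\<Xi> \<in> bidual sE" "\<forall>\<psi>\<in>dual_space sF. \<Xi> (\<lambda>x. \<psi> (\<rho> x)) = z \<psi>"
    using lift_to_bidual[OF E F \<rho>(2,3) dual_comp z] by blast
  show ?thesis
  proof (cases "\<exists>\<phi>\<in>dual_space sE. \<Xi> \<phi> \<noteq> 0")
    case False
    have "z = fun_scale (*) 0 z"
    proof
      fix \<psi> show "z \<psi> = fun_scale (*) 0 z \<psi>"
        using False \<Xi>(2) dual_comp z
        by (cases "\<psi> \<in> dual_space sF") (auto simp: fun_scale_def bidual_def dual_outside)
    qed
    from fun_cong[OF this, of f] arg_cong[OF this, of f'] show ?thesis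
      unfolding f'_scale[OF z] by (simp add: fun_scale_def)
  next
    case True
    then obtain \<phi>0 where \<phi>0: "\<phi>0 \<in> dual_space sE" "\<Xi> \<phi>0 \<noteq> 0" by blast
    define r where "r = bidual_norm sE \<Xi>"
    have r: "r \<ge> 0" using HE' \<Xi>(1) unfolding r_def bidual_norm_def bidual_def by (rule dual_norm_nonneg)
    obtain U where U: "ultrafilter U" "\<forall>\<^sub>F x in U. norm x \<le> r"
      "\<And>\<phi>. \<phi> \<in> dual_space sE \<Longrightarrow> (\<phi> \<longlongrightarrow> \<Xi> \<phi>) U"
      using Goldstine[OF E \<Xi>(1)] unfolding r_def by blast
    have ne: "U \<noteq> bot" using U(1) by (simp add: ultrafilter_def)
    define L where "L P = bidual_limit sF U P" for P :: "'e \<Rightarrow> 'f"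
    have P_le: "\<forall>\<^sub>F x in U. norm (P x) \<le> poly_norm P * r ^ n" if P: "P \<in> ?X" for P
      using U(2)
    proof eventually_elim
      case (elim x)
      have "norm (P x) \<le> poly_norm P * norm x ^ n" by (rule norm_hom_poly_le[OF E F P])
      also have "\<dots> \<le> poly_norm P * r ^ n"
        using elim poly_norm_nonneg[OF E F P] by (intro mult_left_mono power_mono) auto
      finally show ?case .
    qed
    have L_tendsto: "((\<lambda>x. \<psi> (P x)) \<longlongrightarrow> L P \<psi>) U" if "P \<in> ?X" "\<psi> \<in> dual_space sF" for P \<psi>
      unfolding L_def using that by (intro bidual_limit_tendsto[OF F U(1) P_le])
    have L: "L P \<in> bidual sF" "bidual_norm sF (L P) \<le> poly_norm P * r ^ n" if "P \<in> ?X" for P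
      unfolding L_def using bidual_limit_bidual[OF F U(1) P_le[OF that]] .
    have L_outside: "L P \<psi> = 0" if "\<psi> \<notin> dual_space sF" for P \<psi>
      using that by (simp add: L_def bidual_limit_def)
    have L_eqI: "L P = w" if "\<And>\<psi>. \<psi> \<in> dual_space sF \<Longrightarrow> ((\<lambda>x. \<psi> (P x)) \<longlongrightarrow> w \<psi>) U"
      "\<And>\<psi>. \<psi> \<notin> dual_space sF \<Longrightarrow> w \<psi> = 0" for P w
      unfolding L_def using that by (rule bidual_limit_eqI[OF ne])
    have L_add: "L (P + Q) = L P + L Q" if "P \<in> ?X" "Q \<in> ?X" for P Q
      using that by (intro L_eqI) (auto simp: L_outside dual_space_add intro!: tendsto_add L_tendsto)
    have L_scale: "L (fun_scale sF c P) = fun_scale (*) c (L P)" if "P \<in> ?X" for c P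
      using that by (intro L_eqI)
        (auto simp: fun_scale_def L_outside dual_space_scale intro!: tendsto_mult_left L_tendsto)
    \<comment> \<open>Weakly continuous polynomials have their limits in \<open>F\<close>, where \<open>f'\<close> and evaluation at \<open>f\<close> agree.\<close>
    have L_weak: "\<exists>y. L P = canonical_embedding sF y" if P: "P \<in> ?J" for P
    proof -
      have "\<exists>y. (P \<longlongrightarrow> y) U"
        using P U(2,3)
        by (intro tendsto_weakly_Cauchy[OF E degree_le_hom_poly _ ne]) (auto simp: weak_hom_polys_def)
      then obtain y where y: "(P \<longlongrightarrow> y) U" ..
      have "L P = canonical_embedding sF y"
        by (rule L_eqI)
          (auto simp: canonical_embedding_def intro: bounded_linear.tendsto[OF bounded_linear_dual_space[OF F] y])
      then show ?thesis ..
    qed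
    define K where "K = dual_space_norm f * r ^ n"
    have f_nonneg: "dual_space_norm f \<ge> 0" by (rule dual_norm_nonneg[OF HF f])
    then have K: "K \<ge> 0" using r by (simp add: K_def)
    define \<Phi>1 where "\<Phi>1 P = (if P \<in> ?X then f' (L P) else 0)" for P
    define \<Phi>2 where "\<Phi>2 P = (if P \<in> ?X then L P f else 0)" for P
    have bound1: "norm (\<Phi>1 P) \<le> K * poly_norm P" if P: "P \<in> ?X" for P
    proof -
      have "norm (f' (L P)) \<le> dual_norm (bidual_norm sF) (bidual sF) f' * bidual_norm sF (L P)"
        by (rule norm_le_dual_norm[OF HF'' f'(1) L(1)[OF P]])
      also have "\<dots> \<le> dual_space_norm f * (poly_norm P * r ^ n)"
        using HF'' L[OF P] f'(3) f_nonneg by (intro mult_mono) (auto simp: homogeneous_norm_def)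
      finally show ?thesis using P by (simp add: \<Phi>1_def K_def mult_ac)
    qed
    have bound2: "norm (\<Phi>2 P) \<le> K * poly_norm P" if P: "P \<in> ?X" for P
    proof -
      have "norm (L P f) \<le> bidual_norm sF (L P) * dual_space_norm f"
        unfolding bidual_norm_def
        by (rule norm_le_dual_norm[OF HF' L(1)[OF P, unfolded bidual_def] f])
      also have "\<dots> \<le> (poly_norm P * r ^ n) * dual_space_norm f"
        using L(2)[OF P] f_nonneg by (rule mult_right_mono)
      finally show ?thesis using P by (simp add: \<Phi>2_def K_def mult_ac)
    qed
    have \<Phi>1: "\<Phi>1 \<in> dual (fun_scale sF) poly_norm ?X"
    proof (rule dualI[OF _ _ _ bound1])
      show "\<Phi>1 (P + Q) = \<Phi>1 P + \<Phi>1 Q" if "P \<in> ?X" "Q \<in> ?X" for P Q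
        using that hom_poly_add[OF E F that] by (simp add: \<Phi>1_def L_add dual_add[OF f'(1)] L)
      show "\<Phi>1 (fun_scale sF c P) = c * \<Phi>1 P" if "P \<in> ?X" for c P
        using that hom_poly_fun_scale[OF E F that] by (simp add: \<Phi>1_def L_scale f'_scale L)
    qed (auto simp: \<Phi>1_def)
    have \<Phi>2: "\<Phi>2 \<in> dual (fun_scale sF) poly_norm ?X"
    proof (rule dualI[OF _ _ _ bound2])
      show "\<Phi>2 (P + Q) = \<Phi>2 P + \<Phi>2 Q" if "P \<in> ?X" "Q \<in> ?X" for P Q
        using that hom_poly_add[OF E F that] by (simp add: \<Phi>2_def L_add)
      show "\<Phi>2 (fun_scale sF c P) = c * \<Phi>2 P" if "P \<in> ?X" for c P
        using that hom_poly_fun_scale[OF E F that] 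
        by (simp only: \<Phi>2_def L_scale if_True) (simp add: fun_scale_def)
    qed (auto simp: \<Phi>2_def)
    define g where "g P = (if P \<in> ?J then \<Phi>2 P else 0)" for P
    have \<Phi>1_g: "\<Phi>1 P = g P" and \<Phi>2_g: "\<Phi>2 P = g P" if P: "P \<in> ?J" for P
    proof -
      obtain y where y: "L P = canonical_embedding sF y" using L_weak[OF P] ..
      have "P \<in> ?X" using P JX by blast
      then have "\<Phi>1 P = f y" "\<Phi>2 P = f y"
        by (simp_all add: \<Phi>1_def \<Phi>2_def y f'(2) canonical_embedding_apply[OF f])
      then show "\<Phi>2 P = g P" "\<Phi>1 P = g P" using P by (simp_all add: g_def)
    qed
    have J_add: "P + Q \<in> ?J" if "P \<in> ?J" "Q \<in> ?J" for P Q
      using subspace_weak_hom_polys that unfolding module.subspace_def[OF module_fun_scale] by blast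
    have J_scale: "fun_scale sF c P \<in> ?J" if "P \<in> ?J" for c P
      using subspace_weak_hom_polys that unfolding module.subspace_def[OF module_fun_scale] by blast
    have g: "g \<in> dual (fun_scale sF) poly_norm ?J"
    proof (rule dualI[where C = K])
      show "g (P + Q) = g P + g Q" if PQ: "P \<in> ?J" "Q \<in> ?J" for P Q
      proof -
        have "\<Phi>2 (P + Q) = \<Phi>2 P + \<Phi>2 Q"
          by (rule dual_add[OF \<Phi>2]) (use PQ JX in auto)
        then show ?thesis using PQ J_add[OF PQ] by (simp only: g_def if_True)
      qed
      show "g (fun_scale sF c P) = c * g P" if P: "P \<in> ?J" for c P
      proof -
        have "\<Phi>2 (fun_scale sF c P) = c * \<Phi>2 P"
          by (rule dual_scale[OF \<Phi>2]) (use P JX in auto)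
        then show ?thesis using P J_scale[OF P] by (simp only: g_def if_True)
      qed
      show "norm (g P) \<le> K * poly_norm P" if "P \<in> ?J" for P
        using that JX bound2[of P] by (auto simp: g_def)
    qed (simp add: g_def)
    \<comment> \<open>The estimates \<open>rank_one\<close> and \<open>f_times\<close> lead to \<open>K \<le> G\<close>, that is, the norm does not drop on
      restriction to the weakly continuous polynomials.\<close>
    define G where "G = dual_norm poly_norm ?J g"
    have G: "G \<ge> 0" unfolding G_def by (rule dual_norm_nonneg[OF HJ g])
    have rank_one: "norm (f y) * norm (\<Xi> \<phi>) ^ n \<le> G * dual_space_norm \<phi> ^ n * norm y"
      if \<phi>: "\<phi> \<in> dual_space sE" for \<phi> y
    proof -
      define p where "p x = sF (\<phi> x ^ n) y" for x
      have p: "p \<in> ?J" unfolding p_def[abs_def] m by (rule power_times_vector_weak_hom_poly[OF \<phi>])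
      then have pX: "p \<in> ?X" using JX by blast
      have "((\<lambda>x. f (p x)) \<longlongrightarrow> \<Xi> \<phi> ^ n * f y) U"
        unfolding p_def dual_space_scale[OF f]
        by (intro tendsto_mult tendsto_power U(3)[OF \<phi>] tendsto_const)
      then have "L p f = \<Xi> \<phi> ^ n * f y"
        using tendsto_unique[OF ne L_tendsto[OF pX f]] by blast
      then have "g p = \<Xi> \<phi> ^ n * f y" using p pX by (simp add: g_def \<Phi>2_def)
      then have "norm (f y) * norm (\<Xi> \<phi>) ^ n = norm (g p)" by (simp add: norm_mult norm_power)
      also have "\<dots> \<le> G * poly_norm p" unfolding G_def by (rule norm_le_dual_norm[OF HJ g p])
      also have "G * poly_norm p \<le> G * (dual_space_norm \<phi> ^ n * norm y)"
      proof (rule mult_left_mono[OF _ G], rule poly_norm_le)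
        fix x :: 'e assume x: "norm x \<le> 1"
        have "norm (\<phi> x) \<le> dual_space_norm \<phi> * norm x" by (rule dual_space_bound[OF E \<phi>])
        also have "\<dots> \<le> dual_space_norm \<phi>"
          using x dual_norm_nonneg[OF homogeneous_norm_UNIV[OF E] \<phi>] by (simp add: mult_left_le)
        finally show "norm (p x) \<le> dual_space_norm \<phi> ^ n * norm y"
          unfolding p_def F.norm_scale norm_power by (intro mult_right_mono power_mono) auto
      qed
      finally show ?thesis by (simp only: mult.assoc)
    qed
    have f_times: "dual_space_norm f * norm (\<Xi> \<phi>) ^ n \<le> G * dual_space_norm \<phi> ^ n"
      if \<phi>: "\<phi> \<in> dual_space sE" for \<phi>
    proof -
      define a d where "a = norm (\<Xi> \<phi>) ^ n" and "d = dual_space_norm \<phi> ^ n"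
      have "dual_space_norm \<phi> \<ge> 0" by (rule dual_norm_nonneg[OF homogeneous_norm_UNIV[OF E] \<phi>])
      then have "a \<ge> 0" "d \<ge> 0" by (auto simp: a_def d_def)
      show ?thesis
      proof (cases "a = 0")
        case True
        then show ?thesis using G \<open>d \<ge> 0\<close> by (simp flip: a_def d_def)
      next
        case False
        with \<open>a \<ge> 0\<close> have a: "a > 0" by simp
        have "dual_space_norm f \<le> G * d / a"
        proof (rule dual_norm_le[OF HF])
          show "norm (f y) \<le> G * d / a * norm y" for y
            using rank_one[OF \<phi>, of y] a by (simp add: pos_le_divide_eq flip: a_def d_def)
          show "0 \<le> G * d / a" using G \<open>d \<ge> 0\<close> a by simp
        qed
        then show ?thesis using a by (simp add: pos_le_divide_eq flip: a_def d_def)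
      qed
    qed
    have "K \<le> G"
    proof (cases "dual_space_norm f = 0")
      case True
      then show ?thesis using G by (simp add: K_def)
    next
      case False
      then have pos: "dual_space_norm f > 0" using f_nonneg by simp
      \<comment> \<open>\<open>f_times\<close> says that \<open>b\<close> is a bound for \<open>\<Xi>\<close>, hence for its norm \<open>r\<close>.\<close>
      define b where "b = root n (G / dual_space_norm f)"
      have b: "b \<ge> 0" "b ^ n = G / dual_space_norm f"
        using G pos n by (auto simp: b_def)
      have "norm (\<Xi> \<phi>) \<le> b * dual_space_norm \<phi>" if \<phi>: "\<phi> \<in> dual_space sE" for \<phi>
      proof -
        have nonneg: "dual_space_norm \<phi> \<ge> 0" by (rule dual_norm_nonneg[OF homogeneous_norm_UNIV[OF E] \<phi>])
        have "norm (\<Xi> \<phi>) ^ n \<le> (b * dual_space_norm \<phi>) ^ n"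
          using f_times[OF \<phi>] pos unfolding power_mult_distrib b(2)
          by (simp add: pos_le_divide_eq mult.commute)
        then show ?thesis using n b nonneg by (simp add: power_mono_iff)
      qed
      then have "r \<le> b" unfolding r_def bidual_norm_def using b by (intro dual_norm_le[OF HE'])
      then have "r ^ n \<le> b ^ n" using r by (intro power_mono)
      then have "r ^ n \<le> G / dual_space_norm f" by (simp add: b)
      then show ?thesis using pos by (simp add: K_def pos_le_divide_eq mult.commute)
    qed
    have norm1: "dual_norm poly_norm ?X \<Phi>1 = G"
    proof (rule antisym)
      show "dual_norm poly_norm ?X \<Phi>1 \<le> G"
        using dual_norm_le[OF HX K bound1] \<open>K \<le> G\<close> by linarith
      show "G \<le> dual_norm poly_norm ?X \<Phi>1"
        unfolding G_def by (rule dual_norm_restrict_le[OF HX HJ JX \<Phi>1]) (simp add: \<Phi>1_g)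
    qed
    have norm2: "dual_norm poly_norm ?X \<Phi>2 = G"
    proof (rule antisym)
      show "dual_norm poly_norm ?X \<Phi>2 \<le> G"
        using dual_norm_le[OF HX K bound2] \<open>K \<le> G\<close> by linarith
      show "G \<le> dual_norm poly_norm ?X \<Phi>2"
        unfolding G_def by (rule dual_norm_restrict_le[OF HX HJ JX \<Phi>2]) (simp add: \<Phi>2_g)
    qed
    have "\<exists>!\<Phi>. \<Phi> \<in> dual (fun_scale sF) poly_norm ?X \<and> (\<forall>P\<in>?J. \<Phi> P = g P) \<and>
        dual_norm poly_norm ?X \<Phi> = dual_norm poly_norm ?J g"
      using smooth g unfolding HB_smooth_def by blast
    then have "\<Phi>1 = \<Phi>2"
      using \<Phi>1 \<Phi>2 \<Phi>1_g \<Phi>2_g norm1 norm2 unfolding G_def by blast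
    \<comment> \<open>The polynomial that separates \<open>f'\<close> from evaluation at \<open>f\<close>: its limit is a nonzero multiple of \<open>z\<close>.\<close>
    define P0 where "P0 x = sF (\<phi>0 x ^ m) (\<rho> x)" for x
    have P0: "P0 \<in> ?X"
      unfolding P0_def[abs_def] m
      using bounded_linear.continuous_on[OF \<rho>(2) continuous_on_id]
      by (intro linear_times_power_hom_poly[OF E F \<phi>0(1) \<rho>(1)])
    have L_P0: "L P0 = fun_scale (*) (\<Xi> \<phi>0 ^ m) z"
    proof (rule L_eqI)
      fix \<psi>
      show "fun_scale (*) (\<Xi> \<phi>0 ^ m) z \<psi> = 0" if "\<psi> \<notin> dual_space sF"
        using z that by (simp add: fun_scale_def bidual_def dual_outside)
      assume \<psi>: "\<psi> \<in> dual_space sF"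
      have "((\<lambda>x. \<phi>0 x ^ m * \<psi> (\<rho> x)) \<longlongrightarrow> \<Xi> \<phi>0 ^ m * \<Xi> (\<lambda>x. \<psi> (\<rho> x))) U"
        by (intro tendsto_mult tendsto_power U(3) \<phi>0(1) dual_comp \<psi>)
      then show "((\<lambda>x. \<psi> (P0 x)) \<longlongrightarrow> fun_scale (*) (\<Xi> \<phi>0 ^ m) z \<psi>) U"
        using \<Xi>(2) \<psi> by (simp add: P0_def dual_space_scale[OF \<psi>] fun_scale_def)
    qed
    have "f' (L P0) = L P0 f"
      using fun_cong[OF \<open>\<Phi>1 = \<Phi>2\<close>, of P0] P0 by (simp only: \<Phi>1_def \<Phi>2_def if_True)
    then have "\<Xi> \<phi>0 ^ m * f' z = \<Xi> \<phi>0 ^ m * z f"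
      unfolding L_P0 f'_scale[OF z] by (simp only: fun_scale_def)
    then show ?thesis using \<phi>0(2) by simp
  qed
qed

end

end

text \<open>
  A functional \<open>g\<close> on the copy of \<open>F\<close> in \<open>F\<^sup>*\<^sup>*\<close> corresponds to \<open>f \<in> F\<^sup>*\<close>; evaluation at \<open>f\<close> is an
  extension, and its norm is \<open>\<parallel>f\<parallel> = \<parallel>g\<parallel>\<close>. By \<open>extension_to_bidual_unique\<close> it is the only one.
\<close>

theorem proposition4p1:
  fixes sE :: "'k :: real_or_complex \<Rightarrow> 'e :: banach \<Rightarrow> 'e"
    and sF :: "'k \<Rightarrow> 'f :: banach \<Rightarrow> 'f"
    and \<rho> :: "'e \<Rightarrow> 'f"
    and n :: nat
  assumes "banach_space_over sE" and "banach_space_over sF"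
    and "Vector_Spaces.linear sE sF \<rho>" and "bounded_linear \<rho>" and "surj \<rho>"
    and "n \<ge> 1"
    and "HB_smooth (fun_scale sF) poly_norm (weak_hom_polys sE sF n) (hom_polys sE sF n)"
  shows "HB_smooth (fun_scale (*)) (bidual_norm sF) (range (canonical_embedding sF)) (bidual sF)"
  unfolding HB_smooth_def
proof (intro conjI ballI)
  note E = assms(1) and F = assms(2)
  let ?c = "canonical_embedding sF"
  note HF = homogeneous_norm_UNIV[OF F] and HF' = homogeneous_norm_dual_space[OF F]
    and HF'' = homogeneous_norm_bidual[OF F]
  show closed: "closed_subspace (fun_scale (*)) (bidual_norm sF) (range ?c) (bidual sF)"
    by (rule closed_subspace_canonical_embedding[OF F])
  fix g assume g: "g \<in> dual (fun_scale (*)) (bidual_norm sF) (range ?c)"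
  have sub: "range ?c \<subseteq> bidual sF" using canonical_embedding_bidual(1)[OF F] by blast
  have HR: "homogeneous_norm (fun_scale (*)) (bidual_norm sF) (range ?c)"
    using closed unfolding closed_subspace_def module.subspace_def[OF module_fun_scale_mult]
    by (intro homogeneous_norm_subset[OF HF'' sub]) blast+
  have g_norm: "0 \<le> dual_norm (bidual_norm sF) (range ?c) g" by (rule dual_norm_nonneg[OF HR g])
  define f where "f y = g (?c y)" for y
  have f_le: "norm (f y) \<le> dual_norm (bidual_norm sF) (range ?c) g * norm y" for y
  proof -
    have "norm (f y) \<le> dual_norm (bidual_norm sF) (range ?c) g * bidual_norm sF (?c y)"
      unfolding f_def by (rule norm_le_dual_norm[OF HR g]) simp
    also have "\<dots> \<le> dual_norm (bidual_norm sF) (range ?c) g * norm y"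
      using canonical_embedding_bidual(2)[OF F] g_norm by (rule mult_left_mono)
    finally show ?thesis .
  qed
  have f: "f \<in> dual_space sF"
    by (rule dualI[OF _ _ _ f_le])
      (auto simp: f_def canonical_embedding_add canonical_embedding_scale
        dual_add[OF g] dual_scale[OF g])
  have f_norm: "dual_space_norm f \<le> dual_norm (bidual_norm sF) (range ?c) g"
    by (rule dual_norm_le[OF HF g_norm f_le])
  define f1 where "f1 z = (if z \<in> bidual sF then z f else 0)" for z
  have f1_le: "norm (f1 z) \<le> dual_space_norm f * bidual_norm sF z" if "z \<in> bidual sF" for z
    using norm_le_dual_norm[OF HF' that[unfolded bidual_def] f] that
    by (simp add: f1_def bidual_norm_def mult.commute)
  have f1: "f1 \<in> dual (fun_scale (*)) (bidual_norm sF) (bidual sF)"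
  proof (rule dualI[OF _ _ _ f1_le])
    show "f1 (z + w) = f1 z + f1 w" if "z \<in> bidual sF" "w \<in> bidual sF" for z w
      using that dual_closed_add[of z _ _ _ w] by (simp add: f1_def bidual_def)
    show "f1 (fun_scale (*) c z) = c * f1 z" if "z \<in> bidual sF" for c z
      using that HF'' by (simp add: f1_def homogeneous_norm_def) (simp add: fun_scale_def)
  qed (simp add: f1_def)
  have f1_g: "f1 x = g x" if "x \<in> range ?c" for x
    using that sub f by (auto simp: f1_def f_def canonical_embedding_def)
  have norm_f1: "dual_norm (bidual_norm sF) (bidual sF) f1 \<le> dual_space_norm f"
    by (rule dual_norm_le[OF HF'' dual_norm_nonneg[OF HF f] f1_le])
  have norm_g: "dual_norm (bidual_norm sF) (range ?c) g \<le> dual_norm (bidual_norm sF) (bidual sF) f1"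
    by (rule dual_norm_restrict_le[OF HF'' HR sub f1]) (simp add: f1_g)
  show "\<exists>!f. f \<in> dual (fun_scale (*)) (bidual_norm sF) (bidual sF) \<and> (\<forall>x\<in>range ?c. f x = g x) \<and>
      dual_norm (bidual_norm sF) (bidual sF) f = dual_norm (bidual_norm sF) (range ?c) g"
  proof (rule ex1I[of _ f1])
    show "f1 \<in> dual (fun_scale (*)) (bidual_norm sF) (bidual sF) \<and> (\<forall>x\<in>range ?c. f1 x = g x) \<and>
      dual_norm (bidual_norm sF) (bidual sF) f1 = dual_norm (bidual_norm sF) (range ?c) g"
      using f1 f1_g norm_f1 norm_g f_norm by auto
    fix f2 assume f2: "f2 \<in> dual (fun_scale (*)) (bidual_norm sF) (bidual sF) \<and> (\<forall>x\<in>range ?c. f2 x = g x) \<and>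
      dual_norm (bidual_norm sF) (bidual sF) f2 = dual_norm (bidual_norm sF) (range ?c) g"
    show "f2 = f1"
    proof
      fix z
      show "f2 z = f1 z"
      proof (cases "z \<in> bidual sF")
        case True
        have "f2 z = z f"
          by (rule extension_to_bidual_unique[OF E F assms(6,7,3,4,5) f _ _ _ True])
            (use f2 norm_g norm_f1 in \<open>auto simp: f_def\<close>)
        then show ?thesis using True by (simp add: f1_def)
      next
        case False
        then show ?thesis using dual_outside[OF conjunct1[OF f2] False] by (simp add: f1_def)
      qed
    qed
  qed
qed

end
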